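(* The functions $f$ and $F$ extend to meromorphic functions on $\mathbb C$ (still denoted $f,F$) satisfying $$f(z+1)F(z)=1,\qquad f(z)=f(z+1)-\frac{1}{f(z+1)},\qquad z\in\mathbb C.$$ Both $f$ and $F$ are holomorphic in the half-plane $\Re z>-1$, and $z=-1$ is a pole of both $f$ and $F$. Moreover, $$\int_0^1 t^x\,d\mu(t)<\infty \text{ for every } x>-1,\qquad \int_0^1\frac{d\mu(t)}{t}=\infty.$$
   Context: Let $(m_n)_{n\ge0}$ be the unique sequence of positive reals with $m_0=1$ and $(1+m_1+\cdots+m_n)\,m_n=1$ for $n\ge1$ (equivalently $m_{n+1}^2+m_{n+1}/m_n-1=0$). It is a Hausdorff moment sequence: let $\mu$ (the "fixed point measure") be the unique probability measure on $[0,1]$ with $\int_0^1 t^n\,d\mu(t)=m_n$ for all $n\ge0$; it satisfies $\mu(\{0\})=\mu(\{1\})=0$. For $\Re z>0$ define the Bernstein transform $f(z)=\int_0^1\frac{1-t^z}{1-t}\,d\mu(t)$ and the Mellin transform $F(z)=\int_0^1 t^z\,d\mu(t)$, where $t^z=e^{z\log t}$ for $t>0$, $t^z:=0$ at $t=0$, and $\frac{1-t^z}{1-t}:=z$ at $t=1$. *)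

theory Defs
  imports "HOL-Complex_Analysis.Complex_Analysis" "HOL-Probability.Probability"
begin

definition fp_seq :: "nat \<Rightarrow> real" where
  "fp_seq = (THE m. m 0 = 1 \<and> (\<forall>n. m n > 0) \<and>
      (\<forall>n\<ge>1. (1 + (\<Sum>k=1..n. m k)) * m n = 1))"

definition fp_measure :: "real measure" where
  "fp_measure = (THE M. sets M = sets borel \<and> prob_space M \<and> emeasure M {0..1} = 1 \<and>
      (\<forall>n. integrable M (\<lambda>t. t ^ n) \<and> (\<integral>t. t ^ n \<partial>M) = fp_seq n))"

text \<open>t^z = exp(z log t) for t > 0, and 0 at t = 0 (values for t < 0 are
  irrelevant since the measure lives on [0,1]).\<close>
definition cpow_real :: "real \<Rightarrow> complex \<Rightarrow> complex" where
  "cpow_real t z = (if t > 0 then exp (z * complex_of_real (ln t)) else 0)"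

definition bern_kernel :: "complex \<Rightarrow> real \<Rightarrow> complex" where
  "bern_kernel z t = (if t = 1 then z else (1 - cpow_real t z) / complex_of_real (1 - t))"

definition bernstein_f :: "complex \<Rightarrow> complex" where
  "bernstein_f z = (\<integral>t. bern_kernel z t \<partial>fp_measure)"

definition mellin_F :: "complex \<Rightarrow> complex" where
  "mellin_F z = (\<integral>t. cpow_real t z \<partial>fp_measure)"

end

theory Submission
  imports Defs
begin

text \<open>The recursion gives \<open>m n - m (n + 1) = m n * (m (n + 1))\<^sup>2\<close>, and since complete monotonicity up to a
  given order is preserved by products and shifts, \<open>m\<close> is completely monotone by induction on the
  order; Bernstein's weights and Helly's theorem then yield the measure. The values
  \<open>1 / f (1 + n / p)\<close> are also completely monotone in \<open>n\<close>, and the push-forward of their measure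
  under \<open>t \<mapsto> t ^ p\<close> has moments \<open>m n\<close>, so that uniqueness gives \<open>f (x + 1) * F x = 1\<close> at positive
  rational \<open>x\<close> and hence everywhere. Together with \<open>f (z + 1) - f z = F z\<close> this becomes
  \<open>f z = f (z + 1) - 1 / f (z + 1)\<close>, which continues \<open>f\<close> to the plane; \<open>f 0 = 0\<close> produces the poles
  at \<open>-1\<close>, and Landau's theorem on Mellin transforms of positive measures gives the integrals.\<close>

section \<open>Completely monotone sequences\<close>

text \<open>At integers the relation \<open>f (n + 1) * F n = 1\<close> is just the telescoped
  recursion, but integers accumulate only at infinity, where the identity theorem gives nothing.
  This forces the detour through grids of step \<open>1 / p\<close>: uniqueness of the moment
  problem converts the known values at integers into values at all positive rationals, and so
  existence and uniqueness are proved for general sequences rather than for \<open>m\<close> alone.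
  The grids start at \<open>1\<close> because \<open>f 1 = 1\<close> normalises the reciprocals to
  total mass one. For the integrals, a pole of the continuation says nothing by itself about the
  measure, since the integral might stop converging before the pole is reached. Expanding at
  \<open>1\<close> settles this: the continuation is holomorphic in the disc of radius
  \<open>2\<close> about \<open>1\<close>, whose closure meets the line \<open>Re z = -1\<close>
  only at \<open>-1\<close>, and positivity of the measure lets the integral follow the series along
  the whole segment.\<close>

definition ndiff :: "(nat \<Rightarrow> real) \<Rightarrow> nat \<Rightarrow> real" where
  "ndiff a n = a n - a (Suc n)"

text \<open>The order is a parameter because for the fixed point sequence order \<open>k + 1\<close>
  is derived from order \<open>k\<close>. Recursing through the difference sequence lets closure
  properties follow by one induction with the sequences generalised.\<close>

primrec completely_monotone_upto :: "nat \<Rightarrow> (nat \<Rightarrow> real) \<Rightarrow> bool" where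
  "completely_monotone_upto 0 a \<longleftrightarrow> (\<forall>n. 0 \<le> a n)"
| "completely_monotone_upto (Suc k) a \<longleftrightarrow> (\<forall>n. 0 \<le> a n) \<and> completely_monotone_upto k (ndiff a)"

lemma cm_Suc_imp: "completely_monotone_upto (Suc k) a \<Longrightarrow> completely_monotone_upto k a"
  by (induction k arbitrary: a) auto

lemma cm_shift: "completely_monotone_upto k a \<Longrightarrow> completely_monotone_upto k (\<lambda>n. a (Suc n))"
proof (induction k arbitrary: a)
  case (Suc k)
  have "ndiff (\<lambda>n. a (Suc n)) = (\<lambda>n. ndiff a (Suc n))"
    by (simp add: ndiff_def fun_eq_iff)
  with Suc show ?case by auto
qed auto

lemma cm_add: "completely_monotone_upto k a \<Longrightarrow> completely_monotone_upto k b \<Longrightarrow> completely_monotone_upto k (\<lambda>n. a n + b n)"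
proof (induction k arbitrary: a b)
  case (Suc k)
  have "ndiff (\<lambda>n. a n + b n) = (\<lambda>n. ndiff a n + ndiff b n)"
    by (simp add: ndiff_def fun_eq_iff)
  with Suc show ?case by auto
qed auto

text \<open>Discrete Leibniz rule: the difference of the product is
  \<open>ndiff a n * b n + a (n + 1) * ndiff b n\<close>, and both summands are products of
  sequences of the lower order.\<close>

lemma cm_mult: "completely_monotone_upto k a \<Longrightarrow> completely_monotone_upto k b \<Longrightarrow> completely_monotone_upto k (\<lambda>n. a n * b n)"
proof (induction k arbitrary: a b)
  case (Suc k)
  have "ndiff (\<lambda>n. a n * b n) = (\<lambda>n. ndiff a n * b n + a (Suc n) * ndiff b n)"
    by (simp add: ndiff_def fun_eq_iff algebra_simps)
  moreover have "completely_monotone_upto k (\<lambda>n. ndiff a n * b n + a (Suc n) * ndiff b n)"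
    using Suc.prems Suc.prems[THEN cm_Suc_imp] by (intro cm_add Suc.IH cm_shift) auto
  ultimately show ?case using Suc.prems by auto
qed auto

text \<open>The difference of \<open>1 / s\<close> is the increment of \<open>s\<close> times two
  neighbouring reciprocals, so order \<open>k\<close> of the factors gives one order more for the
  reciprocals.\<close>

lemma cm_inverse_step:
  assumes "\<And>n. 0 < s n" "completely_monotone_upto k (\<lambda>n. s (Suc n) - s n)" "completely_monotone_upto k (\<lambda>n. 1 / s n)"
  shows "completely_monotone_upto (Suc k) (\<lambda>n. 1 / s n)"
proof -
  have "ndiff (\<lambda>n. 1 / s n) = (\<lambda>n. (s (Suc n) - s n) * (1 / s n * (1 / s (Suc n))))"
    using assms(1) by (auto simp: ndiff_def fun_eq_iff field_simps less_imp_neq[symmetric])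
  moreover have "completely_monotone_upto k (\<lambda>n. (s (Suc n) - s n) * (1 / s n * (1 / s (Suc n))))"
    using assms(2,3) by (intro cm_mult cm_shift[of k "\<lambda>n. 1 / s n"]) auto
  ultimately show ?thesis using assms(1) by (auto simp: less_imp_le)
qed

text \<open>Discrete counterpart of the fact that the reciprocal of a positive Bernstein function is
  completely monotone.\<close>

lemma cm_inverse:
  assumes "\<And>n. 0 < s n" "\<And>k. completely_monotone_upto k (\<lambda>n. s (Suc n) - s n)"
  shows "completely_monotone_upto k (\<lambda>n. 1 / s n)"
proof (induction k)
  case 0
  then show ?case using assms(1) by (simp add: less_imp_le)
next
  case (Suc k)
  with assms show ?case by (intro cm_inverse_step)
qed

lemma cm_funpow: "completely_monotone_upto k a \<Longrightarrow> 0 \<le> (ndiff ^^ k) a n"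
proof (induction k arbitrary: a n)
  case (Suc k)
  then show ?case by (simp add: funpow_Suc_right del: funpow.simps)
qed auto

lemma cm_of_funpow: "(\<And>k n. 0 \<le> (ndiff ^^ k) a n) \<Longrightarrow> completely_monotone_upto k a"
proof (induction k arbitrary: a)
  case 0
  from 0[of 0] show ?case by simp
next
  case (Suc k)
  have "completely_monotone_upto k (ndiff a)"
    using Suc.prems[of "Suc _"] by (intro Suc.IH) (simp add: funpow_Suc_right del: funpow.simps)
  with Suc.prems[of 0] show ?case by simp
qed

section \<open>Bernstein weights and their moments\<close>

text \<open>\<open>ndiff\<close> and the shift operator commute and add up to the identity; this is
  the binomial expansion of the \<open>N\<close>-th power of their sum.\<close>

lemma sum_binomial_ndiff:
  "(\<Sum>i\<le>N. real (N choose i) * (ndiff ^^ (N - i)) a (j + i)) = a j"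
proof (induction N arbitrary: a j)
  case (Suc N)
  let ?g = "\<lambda>i. (ndiff ^^ (Suc N - i)) a (j + i)"
  have "(\<Sum>i\<le>Suc N. real (Suc N choose i) * ?g i)
      = ?g 0 + (\<Sum>i\<le>N. real (Suc N choose Suc i) * ?g (Suc i))"
    by (subst sum.atMost_Suc_shift) simp
  also have "(\<Sum>i\<le>N. real (Suc N choose Suc i) * ?g (Suc i))
      = (\<Sum>i\<le>N. real (N choose i) * ?g (Suc i)) + (\<Sum>i\<le>N. real (N choose Suc i) * ?g (Suc i))"
    by (simp add: sum.distrib[symmetric] algebra_simps)
  also have "(\<Sum>i\<le>N. real (N choose i) * ?g (Suc i)) = a (Suc j)"
    using Suc.IH[of a "Suc j"] by simp
  also have "?g 0 + (a (Suc j) + (\<Sum>i\<le>N. real (N choose Suc i) * ?g (Suc i)))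
      = a (Suc j) + (\<Sum>i\<le>Suc N. real (N choose i) * ?g i)"
    unfolding sum.atMost_Suc_shift by simp
  also have "(\<Sum>i\<le>Suc N. real (N choose i) * ?g i) = (\<Sum>i\<le>N. real (N choose i) * ?g i)"
    by simp
  also have "\<dots> = (\<Sum>i\<le>N. real (N choose i) * (ndiff ^^ (N - i)) (ndiff a) (j + i))"
    by (intro sum.cong refl) (simp add: Suc_diff_le funpow_Suc_right del: funpow.simps)
  also have "\<dots> = ndiff a j" by (rule Suc.IH)
  finally show ?case by (simp add: ndiff_def)
qed auto

text \<open>If \<open>a\<close> is the moment sequence of a measure on [0,1], this is the integral
  of the Bernstein basis polynomial \<open>(n choose k) t^k (1 - t)^(n - k)\<close>; it will be the
  mass placed at \<open>k / n\<close>.\<close>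

definition bernstein_weight :: "(nat \<Rightarrow> real) \<Rightarrow> nat \<Rightarrow> nat \<Rightarrow> real" where
  "bernstein_weight a n k = (if k \<le> n then real (n choose k) * (ndiff ^^ (n - k)) a k else 0)"

lemma bernstein_weight_nonneg:
  assumes "\<And>k. completely_monotone_upto k a" shows "0 \<le> bernstein_weight a n k"
  using cm_funpow[OF assms] by (simp add: bernstein_weight_def)

text \<open>Factorial moments of the weights are exact at every level: \<open>choose_mult\<close>
  cancels \<open>n choose j\<close> and leaves the binomial identity at order \<open>n - j\<close>.
  The case \<open>j = 0\<close> is the total mass.\<close>

lemma sum_bernstein_weight_factorial:
  assumes "j \<le> n"
  shows "(\<Sum>k\<le>n. bernstein_weight a n k * (real (k choose j) / real (n choose j))) = a j"
proof -
  have "(\<Sum>k\<le>n. bernstein_weight a n k * (real (k choose j) / real (n choose j)))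
     = (\<Sum>k\<in>{j..n}. bernstein_weight a n k * (real (k choose j) / real (n choose j)))"
    by (intro sum.mono_neutral_right) (auto simp: binomial_eq_0)
  also have "\<dots> = (\<Sum>k\<in>{j..n}. real ((n - j) choose (k - j)) * (ndiff ^^ (n - k)) a k)"
  proof (intro sum.cong refl)
    fix k assume k: "k \<in> {j..n}"
    have "real (n choose k) * real (k choose j) = real (n choose j) * real ((n - j) choose (k - j))"
      using choose_mult[of j k n] k by (metis atLeastAtMost_iff of_nat_mult)
    then have *: "real (n choose k) * (real (k choose j) / real (n choose j)) = real ((n - j) choose (k - j))"
      using assms by (simp add: field_simps)
    show "bernstein_weight a n k * (real (k choose j) / real (n choose j))
      = real ((n - j) choose (k - j)) * (ndiff ^^ (n - k)) a k"
      unfolding *[symmetric] using k by (simp add: bernstein_weight_def)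
  qed
  also have "\<dots> = (\<Sum>i\<le>n - j. real ((n - j) choose i) * (ndiff ^^ (n - j - i)) a (j + i))"
    using assms by (intro sum.reindex_bij_witness[of _ "\<lambda>i. j + i" "\<lambda>k. k - j"]) auto
  also have "\<dots> = a j" by (rule sum_binomial_ndiff)
  finally show ?thesis .
qed

text \<open>Both quantities are products of \<open>j\<close> factors in [0,1], \<open>k / n\<close>
  against \<open>(k - i) / (n - i)\<close>, so they differ by at most the sum of the factor
  differences, each at most \<open>j / (n - j)\<close>. For \<open>j > k\<close> the binomial
  vanishes and the power is itself small.\<close>

lemma power_minus_choose_ratio_le:
  assumes "k \<le> n" "j < n"
  shows "\<bar>(real k / real n) ^ j - real (k choose j) / real (n choose j)\<bar> \<le> real (j * j) / real (n - j)"
proof (cases "j \<le> k")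
  case False
  then have j: "1 \<le> j" by simp
  have "(real k / real n) ^ j \<le> real k / real n"
    using power_decreasing[of 1 j "real k / real n"] j assms by (simp add: divide_le_eq_1)
  also have "\<dots> \<le> real j / real n"
    using False by (simp add: divide_right_mono)
  also have "\<dots> \<le> real (j * j) / real (n - j)"
    using assms j by (intro frac_le) (auto simp: of_nat_diff)
  finally show ?thesis using False by (simp add: binomial_eq_0)
next
  case True
  have ch: "real (m choose j) = (\<Prod>i<j. (real m - real i)) / fact j" for m
    by (simp add: binomial_gbinomial gbinomial_prod_rev atLeast0LessThan)
  have eq: "real (k choose j) / real (n choose j) = (\<Prod>i<j. (real k - real i) / (real n - real i))"
    by (simp add: ch prod_dividef)
  have "(real k / real n) ^ j = (\<Prod>i<j. real k / real n)" by simp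
  then have "\<bar>(real k / real n) ^ j - real (k choose j) / real (n choose j)\<bar>
     = norm ((\<Prod>i<j. real k / real n) - (\<Prod>i<j. (real k - real i) / (real n - real i)))"
    by (simp add: eq)
  also have "\<dots> \<le> (\<Sum>i<j. norm (real k / real n - (real k - real i) / (real n - real i)))"
    using assms True by (intro norm_prod_diff) (auto simp: divide_le_eq_1)
  also have "\<dots> \<le> (\<Sum>i<j. real j / real (n - j))"
  proof (intro sum_mono)
    fix i assume i: "i \<in> {..<j}"
    have "real k / real n - (real k - real i) / (real n - real i)
       = (real i / (real n - real i)) * ((real n - real k) / real n)"
      using i assms by (simp add: field_simps)
    then have "norm (real k / real n - (real k - real i) / (real n - real i))
       = norm ((real i / (real n - real i)) * ((real n - real k) / real n))" by (simp only:)
    also have "\<dots> = (real i / (real n - real i)) * ((real n - real k) / real n)"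
      using i assms by simp
    also have "\<dots> \<le> (real i / (real n - real i)) * 1"
      using i assms by (intro mult_left_mono) (auto simp: divide_le_eq_1)
    also have "\<dots> \<le> real j / real (n - j)"
      using i assms by (auto intro!: frac_le simp: of_nat_diff)
    finally show "norm (real k / real n - (real k - real i) / (real n - real i)) \<le> real j / real (n - j)" .
  qed
  also have "\<dots> = real (j * j) / real (n - j)" by simp
  finally show ?thesis .
qed

text \<open>Power moments differ from the exact factorial moments by at most \<open>a 0\<close>
  times a quantity of order \<open>1 / n\<close>.\<close>

lemma sum_bernstein_weight_tendsto:
  assumes "\<And>k. completely_monotone_upto k a" 
  shows "(\<lambda>n. \<Sum>k\<le>n. bernstein_weight a n k * (real k / real n) ^ j) \<longlonglongrightarrow> a j"
proof (rule LIM_zero_cancel, rule Lim_null_comparison)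
  let ?S = "\<lambda>n. \<Sum>k\<le>n. bernstein_weight a n k * (real k / real n) ^ j"
  have "norm (?S n - a j) \<le> a 0 * (real (j * j) / real (n - j))" if n: "j < n" for n
  proof -
    have "?S n - a j = (\<Sum>k\<le>n. bernstein_weight a n k *
        ((real k / real n) ^ j - real (k choose j) / real (n choose j)))"
      using sum_bernstein_weight_factorial[of j n a] n
      by (simp add: sum_subtractf right_diff_distrib)
    also have "norm \<dots> \<le> (\<Sum>k\<le>n. bernstein_weight a n k * (real (j * j) / real (n - j)))"
    proof (intro sum_norm_le)
      fix k assume "k \<in> {..n}"
      then show "norm (bernstein_weight a n k * ((real k / real n) ^ j - real (k choose j) / real (n choose j)))
          \<le> bernstein_weight a n k * (real (j * j) / real (n - j))"
        using power_minus_choose_ratio_le[OF _ n] bernstein_weight_nonneg[OF assms]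
        unfolding real_norm_def abs_mult by (intro mult_mono) auto
    qed
    also have "\<dots> = a 0 * (real (j * j) / real (n - j))"
      using sum_bernstein_weight_factorial[of 0 n a] unfolding sum_distrib_right[symmetric] by simp
    finally show ?thesis .
  qed
  then show "\<forall>\<^sub>F n in sequentially. norm (?S n - a j) \<le> a 0 * (real (j * j) / real (n - j))"
    by (intro eventually_sequentiallyI[of "Suc j"]) auto
  show "(\<lambda>n. a 0 * (real (j * j) / real (n - j))) \<longlonglongrightarrow> 0"
    by (intro tendsto_mult_right_zero tendsto_divide_0[OF tendsto_const]
        filterlim_at_top_imp_at_infinity filterlim_compose[OF filterlim_real_sequentially])
       (rule filterlim_minus_const_nat_at_top)
qed

section \<open>The fixed point sequence\<close>

lemma fp_seq_exists:
  "\<exists>m::nat \<Rightarrow> real. m 0 = 1 \<and> (\<forall>n. m n > 0) \<and> (\<forall>n\<ge>1. (1 + (\<Sum>k=1..n. m k)) * m n = 1)"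
proof -
  \<comment> \<open>The positive root \<open>y\<close> of \<open>y * (1 / x + y) = 1\<close>; here
    \<open>1 / x\<close> stands for the sum accumulated before the new term.\<close>
  define next_m where "next_m x = (sqrt (1 / x\<^sup>2 + 4) - 1 / x) / 2" for x :: real
  define m where "m n = (next_m ^^ n) 1" for n
  have pos: "0 < next_m x" if "0 < x" for x
  proof -
    have "sqrt ((1 / x)\<^sup>2) < sqrt (1 / x\<^sup>2 + 4)"
      by (rule real_sqrt_less_mono) (simp add: power_divide)
    then show ?thesis using that by (simp add: next_m_def)
  qed
  have eq: "next_m x * (1 / x + next_m x) = 1" if "0 < x" for x
  proof -
    have "(sqrt (1 / x\<^sup>2 + 4))\<^sup>2 = (1 / x)\<^sup>2 + 4" 
      by (simp add: power_divide)
    moreover have "(r - y) / 2 * (y + (r - y) / 2) = (r\<^sup>2 - y\<^sup>2) / 4" for r y :: real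
      by (simp add: power2_eq_square field_simps)
    then have "next_m x * (1 / x + next_m x) = ((sqrt (1 / x\<^sup>2 + 4))\<^sup>2 - (1 / x)\<^sup>2) / 4"
      unfolding next_m_def .
    ultimately show ?thesis by simp
  qed
  have m_pos: "0 < m n" for n
    by (induction n) (auto simp: m_def pos)
  have "(1 + (\<Sum>k=1..n. m k)) * m n = 1" for n
  proof (induction n)
    case (Suc n)
    then have "1 + (\<Sum>k=1..n. m k) = 1 / m n" using m_pos[of n] by (simp add: field_simps)
    then show ?case using eq[OF m_pos[of n]] by (simp add: m_def mult.commute add.assoc[symmetric])
  qed (simp add: m_def)
  then show ?thesis using m_pos by (intro exI[of _ m]) (auto simp: m_def)
qed

lemma fp_seq_unique:
  fixes m m' :: "nat \<Rightarrow> real"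
  assumes "m 0 = 1" "\<And>n. m n > 0" "\<And>n. n \<ge> 1 \<Longrightarrow> (1 + (\<Sum>k=1..n. m k)) * m n = 1"
  assumes "m' 0 = 1" "\<And>n. m' n > 0" "\<And>n. n \<ge> 1 \<Longrightarrow> (1 + (\<Sum>k=1..n. m' k)) * m' n = 1"
  shows "m n = m' n"
proof (induction n rule: less_induct)
  case (less n)
  show ?case
  proof (cases n)
    case (Suc l)
    define S where "S = 1 + (\<Sum>k=1..l. m k)"
    have S': "S = 1 + (\<Sum>k=1..l. m' k)"
      using less.IH Suc by (auto simp: S_def intro!: sum.cong)
    have "0 < S" unfolding S_def using assms(2) by (intro add_pos_nonneg sum_nonneg) (auto simp: less_imp_le)
    have "(S + m n) * m n = 1" "(S + m' n) * m' n = 1"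
      using assms(3)[of n] assms(6)[of n] Suc S' by (auto simp: S_def add.assoc)
    then have "(m n - m' n) * (S + m n + m' n) = 0" by (simp add: algebra_simps)
    then show ?thesis using \<open>0 < S\<close> assms(2)[of n] assms(5)[of n] by simp
  qed (simp add: assms)
qed

lemma fp_seq_props:
  shows fp_seq_0: "fp_seq 0 = 1" and fp_seq_pos: "fp_seq n > 0"
    and fp_seq_eq: "(1 + (\<Sum>k=1..n. fp_seq k)) * fp_seq n = 1"
proof -
  have "\<exists>!m::nat \<Rightarrow> real. m 0 = 1 \<and> (\<forall>n. m n > 0) \<and> (\<forall>n\<ge>1. (1 + (\<Sum>k=1..n. m k)) * m n = 1)"
    by (rule ex_ex1I[OF fp_seq_exists], rule ext, rule fp_seq_unique) blast+
  note * = theI'[OF this, folded fp_seq_def]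
  from * show 0: "fp_seq 0 = 1" and "fp_seq n > 0" by blast+
  from * show "(1 + (\<Sum>k=1..n. fp_seq k)) * fp_seq n = 1"
    by (cases "n = 0") (simp add: 0, metis One_nat_def Suc_leI neq0_conv)
qed

lemma fp_seq_Suc_diff: "1 / fp_seq (Suc n) - 1 / fp_seq n = fp_seq (Suc n)"
proof -
  have "1 / fp_seq n = 1 + (\<Sum>k=1..n. fp_seq k)" for n
    using fp_seq_eq[of n] fp_seq_pos[of n] by (simp add: field_simps)
  then show ?thesis by simp
qed

lemma cm_fp_seq: "completely_monotone_upto k fp_seq"
proof (induction k)
  case 0
  show ?case using fp_seq_pos by (simp add: less_imp_le)
next
  case (Suc k)
  \<comment> \<open>With \<open>s = 1 / fp_seq\<close> the increments of \<open>s\<close> are the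
    shift of \<open>fp_seq\<close> itself, so both hypotheses of order \<open>k\<close> come from
    the induction hypothesis.\<close>
  have "completely_monotone_upto (Suc k) (\<lambda>n. 1 / (1 / fp_seq n))"
    using Suc fp_seq_pos cm_shift[OF Suc] by (intro cm_inverse_step) (simp_all add: fp_seq_Suc_diff)
  then show ?case by simp
qed

section \<open>The Hausdorff moment problem\<close>

text \<open>Stated through \<open>real_distribution\<close> and an almost-everywhere support
  condition so that weak convergence and Levy's theorem apply directly;
  \<open>has_unit_moments_iff\<close> translates it into the form used for
  \<open>fp_measure\<close>.\<close>

definition has_unit_moments :: "real measure \<Rightarrow> (nat \<Rightarrow> real) \<Rightarrow> bool" where
  "has_unit_moments M a \<longleftrightarrow> real_distribution M \<and> (AE t in M. 0 \<le> t \<and> t \<le> 1) \<and>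
     (\<forall>n. (\<integral>t. t ^ n \<partial>M) = a n)"

lemma real_distribution_integrable_bounded:
  fixes f :: "real \<Rightarrow> 'a::{banach, second_countable_topology}"
  assumes "real_distribution M" "f \<in> borel_measurable borel"
    and "AE t in M. 0 \<le> t \<and> t \<le> 1" "\<And>t. 0 \<le> t \<Longrightarrow> t \<le> 1 \<Longrightarrow> norm (f t) \<le> B"
  shows "integrable M f"
proof -
  interpret real_distribution M by fact
  show ?thesis
  proof (rule integrable_const_bound)
    show "AE t in M. norm (f t) \<le> B"
      using assms(3) by (rule eventually_mono) (use assms(4) in blast)
  qed (use assms(2) in auto)
qed

definition bernstein_measure :: "(nat \<Rightarrow> real) \<Rightarrow> nat \<Rightarrow> real measure" where
  "bernstein_measure a n =
     distr (point_measure {..n} (\<lambda>k. ennreal (bernstein_weight a n k))) borel (\<lambda>k. real k / real n)"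

lemma bernstein_measure_real_distribution:
  assumes "\<And>k. completely_monotone_upto k a" "a 0 = 1"
  shows "real_distribution (bernstein_measure a n)"
proof -
  have "(\<Sum>k\<le>n. bernstein_weight a n k) = 1"
    using sum_bernstein_weight_factorial[of 0 n a] assms(2) by simp
  then have "(\<Sum>k\<le>n. ennreal (bernstein_weight a n k)) = 1"
    using bernstein_weight_nonneg[OF assms(1)] by (subst sum_ennreal) auto
  then have "prob_space (point_measure {..n} (\<lambda>k. ennreal (bernstein_weight a n k)))"
    by (intro prob_spaceI) (simp add: space_point_measure emeasure_point_measure_finite)
  then show ?thesis
    unfolding bernstein_measure_def real_distribution_def real_distribution_axioms_def
    by (auto intro!: prob_space.prob_space_distr)
qed

lemma bernstein_measure_integral:
  fixes g :: "real \<Rightarrow> real"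
  assumes "\<And>k. completely_monotone_upto k a" "g \<in> borel_measurable borel"
  shows "(\<integral>t. g t \<partial>bernstein_measure a n) = (\<Sum>k\<le>n. bernstein_weight a n k * g (real k / real n))"
proof -
  have "(\<integral>t. g t \<partial>bernstein_measure a n)
      = (\<integral>k. g (real k / real n) \<partial>point_measure {..n} (\<lambda>k. ennreal (bernstein_weight a n k)))"
    unfolding bernstein_measure_def using assms(2) by (intro integral_distr) auto
  also have "\<dots> = (\<Sum>k\<le>n. bernstein_weight a n k * g (real k / real n))"
    using bernstein_weight_nonneg[OF assms(1)] by (subst lebesgue_integral_point_measure_finite) auto
  finally show ?thesis .
qed

lemma bernstein_measure_tight:
  assumes "\<And>k. completely_monotone_upto k a" "a 0 = 1"
  shows "tight (bernstein_measure a)"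
proof -
  \<comment> \<open>Tightness is phrased with half-open intervals, and \<open>0\<close> may carry
    mass, so the left end is moved to \<open>-1\<close>.\<close>
  have mass: "measure (bernstein_measure a n) {-1<..1} = 1" for n
  proof -
    interpret real_distribution "bernstein_measure a n"
      by (rule bernstein_measure_real_distribution[OF assms])
    have "measure (bernstein_measure a n) {-1<..1} = (\<integral>t. indicator {-1<..1} t \<partial>bernstein_measure a n)"
      by simp
    also have "\<dots> = (\<Sum>k\<le>n. bernstein_weight a n k * indicator {-1<..1} (real k / real n))"
      using assms(1) by (rule bernstein_measure_integral) simp
    also have "\<dots> = (\<Sum>k\<le>n. bernstein_weight a n k)"
    proof (intro sum.cong refl)
      fix k assume "k \<in> {..n}"
      then have "real k / real n \<in> {-1<..1}"
        by (auto simp: divide_le_eq_1 intro: less_le_trans[of _ 0])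
      then show "bernstein_weight a n k * indicator {-1<..1} (real k / real n) = bernstein_weight a n k"
        by simp
    qed
    also have "\<dots> = 1"
      using sum_bernstein_weight_factorial[of 0 n a] assms(2) by simp
    finally show ?thesis .
  qed
  have "\<exists>x y. x < y \<and> (\<forall>n. 1 - e < measure (bernstein_measure a n) {x<..y})" if "0 < e" for e
    by (rule exI[of _ "-1 :: real"], rule exI[of _ "1 :: real"]) (simp add: mass that)
  then show ?thesis
    unfolding tight_def using bernstein_measure_real_distribution[OF assms] by blast
qed

theorem hausdorff_moment_existence:
  assumes "\<And>k. completely_monotone_upto k a" "a 0 = 1"
  shows "\<exists>M. has_unit_moments M a"
proof -
  obtain r M where r: "strict_mono (r :: nat \<Rightarrow> nat)" and M: "real_distribution M"
    and conv: "weak_conv_m (bernstein_measure a \<circ> id \<circ> r) M"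
    using tight_imp_convergent_subsubsequence[OF bernstein_measure_tight[OF assms] strict_mono_id] by blast
  interpret M: real_distribution M by fact
  note rd = bernstein_measure_real_distribution[OF assms]
  have lim: "(\<lambda>n. \<Sum>k\<le>r n. bernstein_weight a (r n) k * g (real k / real (r n))) \<longlonglongrightarrow> (\<integral>t. g t \<partial>M)"
    if g: "\<And>x. isCont g x" "\<And>x. norm (g x) \<le> 1" for g :: "real \<Rightarrow> real"
  proof -
    have "(\<lambda>n. \<integral>t. g t \<partial>(bernstein_measure a \<circ> id \<circ> r) n) \<longlonglongrightarrow> (\<integral>t. g t \<partial>M)"
      using rd M conv g by (intro weak_conv_imp_integral_bdd_continuous_conv[where B=1]) (auto simp: o_def)
    moreover have "g \<in> borel_measurable borel"
      using g(1) by (intro borel_measurable_continuous_onI continuous_at_imp_continuous_on) auto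
    ultimately show ?thesis using assms(1) by (simp add: bernstein_measure_integral)
  qed
  have unit: "0 \<le> real k / real n \<and> real k / real n \<le> 1" if "k \<le> n" for k n
    using that by (auto simp: divide_le_eq_1)
  \<comment> \<open>The distance to [0,1] capped at \<open>1\<close>: bounded and continuous as weak
    convergence demands, and zero exactly on [0,1]. Its integral being \<open>0\<close> confines
    \<open>M\<close> to the unit interval.\<close>
  define d where "d x = min 1 (max 0 (x - 1) + max 0 (- x))" for x :: real
  have "(\<lambda>n. \<Sum>k\<le>r n. bernstein_weight a (r n) k * d (real k / real (r n))) \<longlonglongrightarrow> (\<integral>t. d t \<partial>M)"
    unfolding d_def by (rule lim) (auto intro!: continuous_intros)
  moreover have "(\<Sum>k\<le>n. bernstein_weight a n k * d (real k / real n)) = 0" for n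
  proof (intro sum.neutral ballI)
    fix k assume "k \<in> {..n}"
    then have "d (real k / real n) = 0" using unit[of k n] by (simp add: d_def)
    then show "bernstein_weight a n k * d (real k / real n) = 0" by simp
  qed
  ultimately have "(\<integral>t. d t \<partial>M) = 0" by (simp add: LIMSEQ_const_iff)
  moreover have "integrable M d"
    unfolding d_def by (intro M.integrable_const_bound[of _ 1]) auto
  ultimately have "AE t in M. d t = 0"
    by (subst (asm) integral_nonneg_eq_0_iff_AE) (auto simp: d_def)
  then have AE: "AE t in M. 0 \<le> t \<and> t \<le> 1"
    by (rule eventually_mono) (auto simp: d_def max_def min_def split: if_splits)
  have "(\<integral>t. t ^ j \<partial>M) = a j" for j
  proof -
    \<comment> \<open>Powers are unbounded on the line; the clamped version is an admissible test
      function and agrees with the power on [0,1].\<close>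
    define h where "h x = (max 0 (min 1 x)) ^ j" for x :: real
    have "(\<lambda>n. \<Sum>k\<le>r n. bernstein_weight a (r n) k * h (real k / real (r n))) \<longlonglongrightarrow> (\<integral>t. h t \<partial>M)"
      unfolding h_def by (rule lim) (auto intro!: continuous_intros simp: power_le_one)
    moreover have "(\<Sum>k\<le>n. bernstein_weight a n k * h (real k / real n))
        = (\<Sum>k\<le>n. bernstein_weight a n k * (real k / real n) ^ j)" for n
    proof (intro sum.cong refl)
      fix k assume "k \<in> {..n}"
      then have "h (real k / real n) = (real k / real n) ^ j" using unit[of k n] by (simp add: h_def)
      then show "bernstein_weight a n k * h (real k / real n) = bernstein_weight a n k * (real k / real n) ^ j"
        by simp
    qed
    ultimately have "(\<integral>t. h t \<partial>M) = a j"
      using LIMSEQ_subseq_LIMSEQ[OF sum_bernstein_weight_tendsto[OF assms(1), of j] r]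
      by (intro LIMSEQ_unique[of _ "\<integral>t. h t \<partial>M" "a j"]) (auto simp: o_def)
    also have "(\<integral>t. h t \<partial>M) = (\<integral>t. t ^ j \<partial>M)"
    proof (rule integral_cong_AE)
      show "AE t in M. h t = t ^ j"
        using AE by (rule eventually_mono) (simp add: h_def)
    qed (auto simp: h_def)
    finally show ?thesis .
  qed
  with AE M show ?thesis unfolding has_unit_moments_def by blast
qed

text \<open>On [0,1] the exponential series of \<open>iexp (t * x)\<close> is dominated by that of
  the exponential of the absolute value of \<open>t\<close>, hence integrates termwise; so the
  moments determine the characteristic function.\<close>

lemma char_unit_moments:
  assumes "has_unit_moments M a"
  shows "(\<lambda>n. (\<i> * complex_of_real t) ^ n /\<^sub>R fact n * complex_of_real (a n)) sums char M t"
proof -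
  interpret real_distribution M using assms by (simp add: has_unit_moments_def)
  have AE: "AE x in M. 0 \<le> x \<and> x \<le> 1" and mom: "\<And>n. (\<integral>x. x ^ n \<partial>M) = a n"
    using assms by (auto simp: has_unit_moments_def)
  let ?f = "\<lambda>n x. (\<i> * complex_of_real t) ^ n /\<^sub>R fact n * complex_of_real (x ^ n)"
  have norm_f: "norm (?f n x) = \<bar>t * x\<bar> ^ n /\<^sub>R fact n" for n x
    by (simp add: norm_mult norm_power abs_mult power_mult_distrib)
  have int_pow: "integrable M (\<lambda>x::real. x ^ n)" for n
    by (rule real_distribution_integrable_bounded[OF _ _ AE, of _ 1])
       (auto simp: power_le_one real_distribution_axioms)
  have int: "integrable M (?f n)" for n
    by (intro integrable_mult_right integrable_of_real int_pow)
  have "(\<lambda>n. \<integral>x. ?f n x \<partial>M) sums (\<integral>x. (\<Sum>n. ?f n x) \<partial>M)"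
  proof (rule sums_integral[OF int])
    show "AE x in M. summable (\<lambda>n. norm (?f n x))"
      unfolding norm_f by (intro AE_I2 sums_summable[OF exp_converges])
    have "(\<integral>x. norm (?f n x) \<partial>M) \<le> \<bar>t\<bar> ^ n /\<^sub>R fact n" for n
    proof -
      have "(\<integral>x. norm (?f n x) \<partial>M) \<le> (\<integral>x. \<bar>t\<bar> ^ n /\<^sub>R fact n \<partial>M)"
      proof (intro integral_mono_AE integrable_norm int)
        show "AE x in M. norm (?f n x) \<le> \<bar>t\<bar> ^ n /\<^sub>R fact n"
          using AE unfolding norm_f
          by (rule eventually_mono)
             (auto simp: abs_mult power_mult_distrib power_le_one mult_left_le intro!: mult_left_mono)
      qed auto
      then show ?thesis by (simp add: prob_space del: space_eq_univ)
    qed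
    then show "summable (\<lambda>n. \<integral>x. norm (?f n x) \<partial>M)"
      by (intro summable_comparison_test_ev[OF _ sums_summable[OF exp_converges, of "\<bar>t\<bar>"]] always_eventually)
         auto
  qed
  moreover have "(\<integral>x. ?f n x \<partial>M) = (\<i> * complex_of_real t) ^ n /\<^sub>R fact n * complex_of_real (a n)" for n
    unfolding mom[of n, symmetric] integral_mult_right_zero integral_complex_of_real ..
  moreover have "(\<Sum>n. ?f n x) = iexp (t * x)" for x
    by (simp add: exp_def power_mult_distrib mult.assoc)
  ultimately show ?thesis unfolding char_def by (simp only:)
qed

theorem hausdorff_moment_unique:
  assumes "has_unit_moments M a" "has_unit_moments N a"
  shows "M = N"
proof (rule Levy_uniqueness)
  show "char M = char N"
    using sums_unique2[OF char_unit_moments[OF assms(1)] char_unit_moments[OF assms(2)]] by (rule ext)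
qed (use assms in \<open>auto simp: has_unit_moments_def\<close>)

lemma has_unit_moments_iff:
  "has_unit_moments M a \<longleftrightarrow> sets M = sets borel \<and> prob_space M \<and> emeasure M {0..1} = 1 \<and>
     (\<forall>n. integrable M (\<lambda>t. t ^ n) \<and> (\<integral>t. t ^ n \<partial>M) = a n)"
proof (cases "real_distribution M")
  case True
  interpret real_distribution M by fact
  have "emeasure M {0..1} = 1 \<longleftrightarrow> (AE t in M. t \<in> {0..1})"
    by (subst AE_in_set_eq_1) (auto simp: emeasure_eq_measure)
  moreover have "integrable M (\<lambda>t::real. t ^ n)" if "AE t in M. 0 \<le> t \<and> t \<le> 1" for n
    by (rule real_distribution_integrable_bounded[OF _ _ that, of _ 1])
       (auto simp: power_le_one True)
  ultimately show ?thesis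
    using True prob_space_axioms by (auto simp: has_unit_moments_def)
next
  case False
  then show ?thesis
    by (auto simp: has_unit_moments_def real_distribution_def real_distribution_axioms_def)
qed

lemma has_unit_moments_fp_measure: "has_unit_moments fp_measure fp_seq"
proof -
  have "\<exists>!M. has_unit_moments M fp_seq"
    using hausdorff_moment_existence[OF cm_fp_seq fp_seq_0] hausdorff_moment_unique by blast
  from theI'[OF this] show ?thesis
    unfolding fp_measure_def has_unit_moments_iff .
qed

section \<open>The functional equation in the right half-plane\<close>

text \<open>A uniform bound on the kernel suffices: Cauchy's inequality turns it into a bound
  \<open>B / r\<close> for the derivatives on a smaller disc, hence for the difference quotients,
  and dominated convergence differentiates under the integral.\<close>

lemma holomorphic_on_integral_bounded:
  fixes K :: "complex \<Rightarrow> 'a \<Rightarrow> complex"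
  assumes "finite_measure M" and S: "open S"
    and meas: "\<And>z. z \<in> S \<Longrightarrow> K z \<in> borel_measurable M"
    and hol: "\<And>t. t \<in> space M \<Longrightarrow> (\<lambda>z. K z t) holomorphic_on S"
    and bound: "AE t in M. \<forall>z\<in>S. norm (K z t) \<le> B"
  shows "(\<lambda>z. \<integral>t. K z t \<partial>M) holomorphic_on S"
proof (rule holomorphic_onI)
  interpret finite_measure M by fact
  have int: "integrable M (K z)" if "z \<in> S" for z
  proof (rule integrable_const_bound)
    show "AE t in M. norm (K z t) \<le> B"
      using bound by (rule eventually_mono) (use that in blast)
  qed (use meas that in blast)
  fix z0 assume z0: "z0 \<in> S"
  obtain e where e: "0 < e" "cball z0 e \<subseteq> S"
    using S z0 by (meson open_contains_cball)
  \<comment> \<open>Half the radius, so that closed discs of radius \<open>r\<close> about points of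
    \<open>ball z0 r\<close> stay inside \<open>S\<close>.\<close>
  define r where "r = e / 2"
  have r: "0 < r" using e by (simp add: r_def)
  have sub: "cball w r \<subseteq> S" if "w \<in> ball z0 r" for w
  proof -
    have "cball w r \<subseteq> cball z0 e"
    proof
      fix x assume "x \<in> cball w r"
      then have "dist z0 x \<le> dist z0 w + r" using dist_triangle[of z0 x w] by simp
      with that show "x \<in> cball z0 e" by (simp add: r_def)
    qed
    with e show ?thesis by simp
  qed
  have sub0: "ball z0 r \<subseteq> S" using e by (auto simp: r_def)
  have lip: "norm (K w t - K z0 t) \<le> B / r * norm (w - z0)"
    if w: "w \<in> ball z0 r" and t: "t \<in> space M" "\<forall>z\<in>S. norm (K z t) \<le> B" for w t
  proof (rule field_differentiable_bound[of "ball z0 r" "\<lambda>z. K z t" "deriv (\<lambda>z. K z t)"])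
    fix z assume z: "z \<in> ball z0 r"
    then have "z \<in> S" using sub0 by auto
    show "((\<lambda>z. K z t) has_field_derivative deriv (\<lambda>z. K z t) z) (at z within ball z0 r)"
      using hol[OF t(1)] S \<open>z \<in> S\<close> by (rule has_field_derivative_at_within[OF holomorphic_derivI])
    have "norm ((deriv ^^ 1) (\<lambda>z. K z t) z) \<le> fact 1 * B / r ^ 1"
    proof (rule Cauchy_inequality)
      show "(\<lambda>z. K z t) holomorphic_on ball z r"
        by (rule holomorphic_on_subset[OF hol[OF t(1)]]) (use sub[OF z] in auto)
      show "continuous_on (cball z r) (\<lambda>z. K z t)"
        by (rule holomorphic_on_imp_continuous_on, rule holomorphic_on_subset[OF hol[OF t(1)]])
           (use sub[OF z] in auto)
      fix x assume "norm (z - x) = r"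
      then have "x \<in> S" using sub[OF z] by (auto simp: dist_norm)
      with t(2) show "norm (K x t) \<le> B" by blast
    qed (use r in auto)
    then show "norm (deriv (\<lambda>z. K z t) z) \<le> B / r" by simp
  qed (use w r in auto)
  define D where "D t = deriv (\<lambda>z. K z t) z0" for t
  have "((\<lambda>y. ((\<integral>t. K y t \<partial>M) - (\<integral>t. K z0 t \<partial>M)) / (y - z0)) \<longlongrightarrow> (\<integral>t. D t \<partial>M)) (at z0 within ball z0 r)"
    unfolding tendsto_at_iff_sequentially
  proof (intro allI impI)
    fix X assume X: "\<forall>i. X i \<in> ball z0 r - {z0}" "X \<longlonglongrightarrow> z0"
    let ?q = "\<lambda>i t. (K (X i) t - K z0 t) / (X i - z0)"
    have X_S: "X i \<in> S" for i using X sub0 by auto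
    have lim: "(\<lambda>i. ?q i t) \<longlonglongrightarrow> D t" if t: "t \<in> space M" for t
    proof -
      have "((\<lambda>z. K z t) has_field_derivative D t) (at z0)"
        unfolding D_def using hol[OF t] S z0 by (rule holomorphic_derivI)
      then have "((\<lambda>y. (K y t - K z0 t) / (y - z0)) \<longlongrightarrow> D t) (at z0)"
        by (simp add: has_field_derivative_iff)
      then show ?thesis
        using X unfolding tendsto_at_iff_sequentially o_def by (elim allE[of _ X] impE) auto
    qed
    have q_meas: "?q i \<in> borel_measurable M" for i
      using meas[OF X_S[of i]] meas[OF z0] by measurable
    have "(\<lambda>i. \<integral>t. ?q i t \<partial>M) \<longlonglongrightarrow> (\<integral>t. D t \<partial>M)"
    proof (rule integral_dominated_convergence[where w="\<lambda>_. B / r"])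
      show "D \<in> borel_measurable M"
        by (rule borel_measurable_LIMSEQ_metric[OF q_meas lim])
      show "AE t in M. norm (?q i t) \<le> B / r" for i
        using bound AE_space
      proof eventually_elim
        case (elim t)
        then have "norm (K (X i) t - K z0 t) \<le> B / r * norm (X i - z0)"
          using X by (intro lip) auto
        moreover have "0 < norm (X i - z0)" using X(1) by auto
        ultimately show ?case by (simp add: norm_divide field_simps)
      qed
    qed (use lim q_meas in auto)
    moreover have "(\<integral>t. ?q i t \<partial>M) = ((\<integral>t. K (X i) t \<partial>M) - (\<integral>t. K z0 t \<partial>M)) / (X i - z0)" for i
      using int[OF X_S[of i]] int[OF z0] by simp
    ultimately show "((\<lambda>y. ((\<integral>t. K y t \<partial>M) - (\<integral>t. K z0 t \<partial>M)) / (y - z0)) \<circ> X) \<longlonglongrightarrow> (\<integral>t. D t \<partial>M)"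
      by (simp only: o_def)
  qed
  then have "((\<lambda>z. \<integral>t. K z t \<partial>M) has_field_derivative (\<integral>t. D t \<partial>M)) (at z0)"
    using r at_within_open[of z0 "ball z0 r"] by (simp add: has_field_derivative_iff)
  then have "(\<lambda>z. \<integral>t. K z t \<partial>M) field_differentiable at z0"
    unfolding field_differentiable_def by (rule exI)
  then show "(\<lambda>z. \<integral>t. K z t \<partial>M) field_differentiable at z0 within S"
    by (rule field_differentiable_at_within)
qed

section \<open>The fixed point measure and its two transforms\<close>

interpretation fp: real_distribution fp_measure
  using has_unit_moments_fp_measure by (simp add: has_unit_moments_def)

lemma fp_AE_unit: "AE t in fp_measure. 0 \<le> t \<and> t \<le> 1"
  using has_unit_moments_fp_measure by (simp add: has_unit_moments_def)

lemma fp_moment: "(\<integral>t. t ^ n \<partial>fp_measure) = fp_seq n"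
  using has_unit_moments_fp_measure by (simp add: has_unit_moments_def)

lemma fp_integrable_bounded:
  fixes f :: "real \<Rightarrow> 'a::{banach, second_countable_topology}"
  assumes "f \<in> borel_measurable borel" "\<And>t. 0 \<le> t \<Longrightarrow> t \<le> 1 \<Longrightarrow> norm (f t) \<le> B"
  shows "integrable fp_measure f"
  using real_distribution_integrable_bounded[OF fp.real_distribution_axioms _ fp_AE_unit] assms by blast

lemma fp_integral_cong:
  fixes f g :: "real \<Rightarrow> 'a::{banach, second_countable_topology}"
  assumes "f \<in> borel_measurable borel" "g \<in> borel_measurable borel"
    and "\<And>t. 0 \<le> t \<Longrightarrow> t \<le> 1 \<Longrightarrow> f t = g t"
  shows "(\<integral>t. f t \<partial>fp_measure) = (\<integral>t. g t \<partial>fp_measure)"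
proof (rule integral_cong_AE)
  show "AE t in fp_measure. f t = g t"
    using fp_AE_unit by (rule eventually_mono) (use assms(3) in blast)
qed (use assms in auto)

lemma cpow_real_measurable [measurable]: "(\<lambda>t. cpow_real t z) \<in> borel_measurable borel"
  unfolding cpow_real_def by measurable

lemma bern_kernel_measurable [measurable]: "bern_kernel z \<in> borel_measurable borel"
  unfolding bern_kernel_def by measurable

lemma cpow_real_of_real: "0 \<le> t \<Longrightarrow> cpow_real t (complex_of_real x) = complex_of_real (t powr x)"
  using exp_of_real[of "x * ln t", where ?'a = complex] by (simp add: cpow_real_def powr_def)

lemma cpow_real_add: "cpow_real t (z + w) = cpow_real t z * cpow_real t w"
  by (simp add: cpow_real_def exp_add ring_distribs)

lemma norm_cpow_real: "0 \<le> t \<Longrightarrow> norm (cpow_real t z) = t powr Re z"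
  by (auto simp: cpow_real_def powr_def)

lemma norm_cpow_real_le_1:
  assumes "0 \<le> t" "t \<le> 1" "0 \<le> Re z" shows "norm (cpow_real t z) \<le> 1"
  using assms powr_mono2[of "Re z" t 1] by (simp add: norm_cpow_real)

text \<open>For \<open>t \<le> 1 / 2\<close> the denominator is at least \<open>1 / 2\<close> and
  the numerator at most \<open>2\<close>. Nearer to \<open>1\<close>, \<open>exp\<close> being
  1-Lipschitz on the left half-plane bounds the numerator by \<open>norm z * (- ln t)\<close>, and
  \<open>- ln t\<close> is at most \<open>2 * (1 - t)\<close>.\<close>

lemma norm_bern_kernel_le:
  assumes t: "0 \<le> t" "t \<le> 1" and z: "0 \<le> Re z"
  shows "norm (bern_kernel z t) \<le> 4 + 2 * norm z"
proof -
  consider "t = 1" | "t \<le> 1 / 2" | "1 / 2 < t" "t < 1" using t by linarith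
  then show ?thesis
  proof cases
    case 1
    then show ?thesis by (simp add: bern_kernel_def)
  next
    case 2
    have "norm (1 - cpow_real t z) \<le> 1 + 1"
      using norm_cpow_real_le_1[OF t z] norm_triangle_ineq4[of 1 "cpow_real t z"] by simp
    then have "norm (1 - cpow_real t z) \<le> 4 * (1 - t)" using 2 by simp
    then have "norm (bern_kernel z t) \<le> 4"
      using 2 unfolding bern_kernel_def by (simp add: norm_divide divide_le_eq del: of_real_diff)
    also have "\<dots> \<le> 4 + 2 * norm z" by simp
    finally show ?thesis .
  next
    case 3
    have ln: "ln t \<le> 0" "- ln t \<le> 2 * (1 - t)"
    proof -
      show "ln t \<le> 0" using 3 by simp
      have "- ln t = ln (1 / t)" using 3 by (simp add: ln_div)
      also have "\<dots> \<le> 1 / t - 1" using 3 by (intro ln_le_minus_one) simp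
      also have "\<dots> = (1 - t) / t" using 3 by (simp add: field_simps)
      also have "\<dots> \<le> (1 - t) / (1 / 2)" using 3 by (intro divide_left_mono) auto
      finally show "- ln t \<le> 2 * (1 - t)" by simp
    qed
    have "norm (exp 0 - exp (z * complex_of_real (ln t))) \<le> 1 * norm (0 - z * complex_of_real (ln t))"
    proof (rule field_differentiable_bound[of "{w. Re w \<le> 0}" exp exp])
      show "convex {w. Re w \<le> 0}" by (rule convex_halfspace_Re_le)
      show "z * complex_of_real (ln t) \<in> {w. Re w \<le> 0}"
        using ln z by (simp add: mult_nonneg_nonpos)
    qed (auto intro: DERIV_exp has_field_derivative_at_within)
    then have "norm (1 - cpow_real t z) \<le> norm z * (2 * (1 - t))"
      using 3 ln mult_left_mono[OF ln(2), of "norm z"] by (simp add: cpow_real_def norm_mult)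
    then have "norm (bern_kernel z t) \<le> 2 * norm z"
      using 3 unfolding bern_kernel_def by (simp add: norm_divide divide_le_eq field_simps del: of_real_diff)
    then show ?thesis by simp
  qed
qed

lemma integrable_bern_kernel: "0 \<le> Re z \<Longrightarrow> integrable fp_measure (bern_kernel z)"
  by (intro fp_integrable_bounded[where B="4 + 2 * norm z"]) (auto intro: norm_bern_kernel_le)

lemma mellin_F_holomorphic: "mellin_F holomorphic_on {z. 0 < Re z}"
  unfolding mellin_F_def
proof (rule holomorphic_on_integral_bounded)
  show "AE t in fp_measure. \<forall>z\<in>{z. 0 < Re z}. norm (cpow_real t z) \<le> 1"
    using fp_AE_unit by (rule eventually_mono) (auto intro: norm_cpow_real_le_1)
  show "(\<lambda>z. cpow_real t z) holomorphic_on {z. 0 < Re z}" for t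
    by (cases "0 < t") (auto simp: cpow_real_def intro!: holomorphic_intros)
qed (auto simp: open_halfspace_Re_gt fp.finite_measure_axioms)

text \<open>The kernel bound grows with \<open>norm z\<close>, so the half-plane is exhausted by its
  intersections with discs.\<close>

lemma bernstein_f_holomorphic: "bernstein_f holomorphic_on {z. 0 < Re z}"
proof (rule holomorphic_on_subset)
  show "bernstein_f holomorphic_on (\<Union>n. {z. 0 < Re z} \<inter> ball 0 (real n))"
    unfolding bernstein_f_def
  proof (rule holomorphic_on_UN_open)
    fix n
    show "open ({z. 0 < Re z} \<inter> ball 0 (real n))"
      by (intro open_Int open_halfspace_Re_gt open_ball)
    show "(\<lambda>z. \<integral>t. bern_kernel z t \<partial>fp_measure) holomorphic_on {z. 0 < Re z} \<inter> ball 0 (real n)"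
    proof (rule holomorphic_on_integral_bounded)
      show "AE t in fp_measure. \<forall>z\<in>{z. 0 < Re z} \<inter> ball 0 (real n). norm (bern_kernel z t) \<le> 4 + 2 * real n"
        using fp_AE_unit
      proof (rule eventually_mono, intro ballI)
        fix t z assume "0 \<le> t \<and> t \<le> (1::real)" and z: "z \<in> {z. 0 < Re z} \<inter> ball 0 (real n)"
        then have "norm (bern_kernel z t) \<le> 4 + 2 * norm z" by (intro norm_bern_kernel_le) auto
        also have "\<dots> \<le> 4 + 2 * real n" using z by simp
        finally show "norm (bern_kernel z t) \<le> 4 + 2 * real n" .
      qed
      fix t :: real
      have "(\<lambda>z. cpow_real t z) holomorphic_on A" for A
        by (cases "0 < t") (auto simp: cpow_real_def intro!: holomorphic_intros)
      then show "(\<lambda>z. bern_kernel z t) holomorphic_on {z. 0 < Re z} \<inter> ball 0 (real n)"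
        by (cases "t = 1") (auto simp: bern_kernel_def simp del: of_real_diff intro!: holomorphic_intros)
    qed (auto simp: open_halfspace_Re_gt fp.finite_measure_axioms)
  qed
  show "{z. 0 < Re z} \<subseteq> (\<Union>n. {z. 0 < Re z} \<inter> ball 0 (real n))"
    using reals_Archimedean2 by auto
qed

text \<open>The numerators telescope to \<open>t^z * (1 - t)\<close>. At \<open>t = 1\<close> the
  convention for the kernel gives the difference \<open>1\<close>, matching the power there.\<close>

lemma bernstein_f_diff:
  assumes "0 < Re z"
  shows "bernstein_f (z + 1) - bernstein_f z = mellin_F z"
proof -
  have "bernstein_f (z + 1) - bernstein_f z = (\<integral>t. bern_kernel (z + 1) t - bern_kernel z t \<partial>fp_measure)"
    unfolding bernstein_f_def using assms
    by (intro Bochner_Integration.integral_diff[symmetric] integrable_bern_kernel) auto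
  also have "\<dots> = mellin_F z"
    unfolding mellin_F_def
  proof (rule fp_integral_cong)
    fix t :: real assume t: "0 \<le> t" "t \<le> 1"
    have "cpow_real t (z + 1) = cpow_real t z * complex_of_real t"
      using cpow_real_of_real[of t 1] t by (simp add: cpow_real_add)
    then show "bern_kernel (z + 1) t - bern_kernel z t = cpow_real t z"
      by (auto simp: bern_kernel_def cpow_real_def field_simps)
  qed auto
  finally show ?thesis .
qed

text \<open>For \<open>t < 1\<close> the real part of \<open>t^z\<close> is at most
  \<open>t^(Re z) < 1\<close>, so the kernel has positive real part pointwise. This rules out zeros
  of \<open>f\<close> in the half-plane.\<close>

lemma Re_bernstein_f_pos:
  assumes z: "0 < Re z"
  shows "0 < Re (bernstein_f z)"
proof -
  have pos: "0 < Re (bern_kernel z t)" if t: "0 \<le> t" "t \<le> 1" for t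
  proof (cases "t = 1")
    case True
    then show ?thesis using z by (simp add: bern_kernel_def)
  next
    case False
    have "Re (cpow_real t z) \<le> t powr Re z"
      using complex_Re_le_cmod[of "cpow_real t z"] t by (simp add: norm_cpow_real)
    also have "\<dots> < 1"
      using False t z powr_less_mono2[of "Re z" t 1] by simp
    finally show ?thesis using False t by (simp add: bern_kernel_def Re_divide_of_real del: of_real_diff)
  qed
  have int: "integrable fp_measure (\<lambda>t. Re (bern_kernel z t))"
    using z by (intro integrable_Re integrable_bern_kernel) simp
  have AE: "AE t in fp_measure. 0 < Re (bern_kernel z t)"
    using fp_AE_unit by (rule eventually_mono) (use pos in blast)
  have "Re (bernstein_f z) = (\<integral>t. Re (bern_kernel z t) \<partial>fp_measure)"
    unfolding bernstein_f_def using z by (intro integral_Re[symmetric] integrable_bern_kernel) simp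
  moreover have "(\<integral>t. 0 \<partial>fp_measure) < (\<integral>t. Re (bern_kernel z t) \<partial>fp_measure)"
    by (rule fp.integral_less_AE_space[OF _ int AE]) (simp_all add: fp.emeasure_space_1 del: fp.space_eq_univ)
  ultimately show ?thesis by simp
qed

text \<open>Both sides are \<open>1\<close> at \<open>n = 0\<close> and have the increment
  \<open>fp_seq (n + 1)\<close>, the left one by \<open>bernstein_f_diff\<close>, the right one by
  the recursion.\<close>

lemma bernstein_f_nat: "bernstein_f (of_nat (Suc n)) = complex_of_real (1 / fp_seq n)"
proof (induction n)
  case 0
  have "bernstein_f 1 = (\<integral>t. 1 \<partial>fp_measure)"
    unfolding bernstein_f_def
  proof (rule fp_integral_cong)
    fix t :: real assume t: "0 \<le> t" "t \<le> 1"
    then have "cpow_real t 1 = complex_of_real t" using cpow_real_of_real[of t 1] by simp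
    then show "bern_kernel 1 t = 1" by (simp add: bern_kernel_def)
  qed auto
  then show ?case by (simp add: fp_seq_0 fp.prob_space del: fp.space_eq_univ)
next
  case (Suc n)
  have "mellin_F (of_nat (Suc n)) = (\<integral>t. complex_of_real (t ^ Suc n) \<partial>fp_measure)"
    unfolding mellin_F_def
  proof (rule fp_integral_cong)
    fix t :: real assume t: "0 \<le> t" "t \<le> 1"
    have "t powr real (Suc n) = t ^ Suc n"
      using t by (cases "t = 0") (auto simp del: power_Suc of_nat_Suc intro: powr_realpow)
    then show "cpow_real t (of_nat (Suc n)) = complex_of_real (t ^ Suc n)"
      using cpow_real_of_real[of t "real (Suc n)"] t by simp
  qed auto
  also have "\<dots> = complex_of_real (fp_seq (Suc n))"
    unfolding integral_complex_of_real fp_moment ..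
  finally have "bernstein_f (of_nat (Suc (Suc n))) = bernstein_f (of_nat (Suc n)) + complex_of_real (fp_seq (Suc n))"
    using bernstein_f_diff[of "of_nat (Suc n)"] by (simp add: algebra_simps)
  then show ?case unfolding Suc.IH using fp_seq_Suc_diff[of n] 
    by (simp add: of_real_add[symmetric] algebra_simps del: of_real_add of_real_divide)
qed

section \<open>Reciprocity of the two transforms\<close>

lemma ndiff_funpow_integral:
  assumes "\<And>n. integrable M (h n)"
  shows "integrable M (\<lambda>t. (ndiff ^^ k) (\<lambda>n. h n t) n)"
    and "(ndiff ^^ k) (\<lambda>n. \<integral>t. h n t \<partial>M) n = (\<integral>t. (ndiff ^^ k) (\<lambda>n. h n t) n \<partial>M)"
proof (induction k arbitrary: n)
  case 0
  { case 1 show ?case using assms by simp }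
  { case 2 show ?case by simp }
next
  case (Suc k)
  { case 1 show ?case unfolding funpow.simps o_def ndiff_def[of "(ndiff ^^ k) _"]
      by (intro Bochner_Integration.integrable_diff Suc.IH) }
  { case 2 show ?case
      by (simp add: ndiff_def[of "(ndiff ^^ k) _"] Suc.IH Bochner_Integration.integral_diff) }
qed

lemma ndiff_funpow_geometric: "(ndiff ^^ k) (\<lambda>n. c * u ^ n) n = c * u ^ n * (1 - u) ^ k"
  by (induction k arbitrary: n) (simp_all add: ndiff_def[of "(ndiff ^^ _) _"] algebra_simps)

text \<open>The \<open>k\<close>-th difference of the integrand is
  \<open>c * u ^ n * (1 - u) ^ k\<close>, which is nonnegative.\<close>

lemma cm_integral_geometric:
  assumes "\<And>n. integrable M (\<lambda>t. c t * u t ^ n)" "AE t in M. 0 \<le> c t \<and> 0 \<le> u t \<and> u t \<le> (1::real)"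
  shows "completely_monotone_upto k (\<lambda>n. \<integral>t. c t * u t ^ n \<partial>M)"
proof (rule cm_of_funpow)
  fix k n
  have "AE t in M. 0 \<le> c t * u t ^ n * (1 - u t) ^ k"
    using assms(2) by (rule eventually_mono) simp
  then show "0 \<le> (ndiff ^^ k) (\<lambda>n. \<integral>t. c t * u t ^ n \<partial>M) n"
    unfolding ndiff_funpow_integral(2)[OF assms(1)] ndiff_funpow_geometric by (rule integral_nonneg_AE)
qed

lemma bernstein_f_of_real:
  assumes "0 \<le> x"
  shows "bernstein_f (complex_of_real x) = complex_of_real (Re (bernstein_f (complex_of_real x)))"
proof -
  have "bernstein_f (complex_of_real x)
      = (\<integral>t. complex_of_real (Re (bern_kernel (complex_of_real x) t)) \<partial>fp_measure)"
    unfolding bernstein_f_def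
  proof (rule fp_integral_cong)
    fix t :: real assume t: "0 \<le> t" "t \<le> 1"
    then show "bern_kernel (complex_of_real x) t = complex_of_real (Re (bern_kernel (complex_of_real x) t))"
      by (auto simp: bern_kernel_def cpow_real_of_real complex_eq_iff Im_divide_of_real simp del: of_real_diff)
  qed auto
  then show ?thesis unfolding integral_complex_of_real by simp
qed

lemma bernstein_f_step_cm:
  assumes "0 < p"
  shows "completely_monotone_upto k (\<lambda>n. Re (bernstein_f (1 + complex_of_real (real (Suc n) / real p)))
                  - Re (bernstein_f (1 + complex_of_real (real n / real p))))"
proof -
  \<comment> \<open>With \<open>u = t^(1/p)\<close> the kernel at \<open>1 + n / p\<close> has
    numerator \<open>1 - t * u ^ n\<close>, so one step of the grid adds the geometric term
    \<open>c * u ^ n\<close>; at \<open>t = 1\<close> the kernel grows by the step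
    \<open>1 / p\<close> itself.\<close>
  define u where "u t = t powr (1 / real p)" for t
  define c where "c t = (if t = 1 then 1 / real p else t * (1 - u t) / (1 - t))" for t
  define b where "b n t = Re (bern_kernel (1 + complex_of_real (real n / real p)) t)" for n t
  have kernel_int: "integrable fp_measure (bern_kernel (1 + complex_of_real (real n / real p)))" for n
    by (rule integrable_bern_kernel) simp
  have b_int: "integrable fp_measure (b n)" for n
    unfolding b_def by (rule integrable_Re[OF kernel_int])
  have b_integral: "Re (bernstein_f (1 + complex_of_real (real n / real p))) = (\<integral>t. b n t \<partial>fp_measure)" for n
    unfolding bernstein_f_def b_def by (rule integral_Re[OF kernel_int, symmetric])
  have b_eq: "b n t = (if t = 1 then 1 + real n / real p else (1 - t * u t ^ n) / (1 - t))"
    if t: "0 \<le> t" for n t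
  proof -
    have "cpow_real t (1 + complex_of_real (real n / real p)) = complex_of_real (t powr (1 + real n / real p))"
      using cpow_real_of_real[OF t, of "1 + real n / real p"] by simp
    also have "t powr (1 + real n / real p) = t * u t ^ n"
      using t by (cases "t = 0") (auto simp: u_def powr_add powr_powr powr_realpow[symmetric])
    finally show ?thesis
      by (auto simp: b_def bern_kernel_def Re_divide_of_real simp del: of_real_diff of_real_mult of_real_divide)
  qed
  have step: "b (Suc n) t - b n t = c t * u t ^ n" if t: "0 \<le> t" for n t
  proof (cases "t = 1")
    case True
    then show ?thesis by (simp add: b_eq c_def u_def diff_divide_distrib[symmetric])
  next
    case False
    have "b (Suc n) t - b n t = ((1 - t * u t ^ Suc n) - (1 - t * u t ^ n)) / (1 - t)"
      using False by (simp add: b_eq[OF t] diff_divide_distrib)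
    also have "\<dots> = c t * u t ^ n"
      using False by (simp add: c_def algebra_simps)
    finally show ?thesis .
  qed
  have AE_step: "AE t in fp_measure. b (Suc n) t - b n t = c t * u t ^ n" for n
    using fp_AE_unit by (rule eventually_mono) (use step in blast)
  have meas: "c \<in> borel_measurable borel" "u \<in> borel_measurable borel"
    unfolding c_def u_def by measurable
  have int: "integrable fp_measure (\<lambda>t. c t * u t ^ n)" for n
  proof (rule integrable_cong_AE_imp[OF _ _ AE_step])
    show "integrable fp_measure (\<lambda>t. b (Suc n) t - b n t)"
      by (intro Bochner_Integration.integrable_diff b_int)
  qed (use meas in auto)
  have "AE t in fp_measure. 0 \<le> c t \<and> 0 \<le> u t \<and> u t \<le> 1"
    using fp_AE_unit
  proof (rule eventually_mono)
    fix t :: real assume t: "0 \<le> t \<and> t \<le> 1"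
    then have u: "0 \<le> u t" "u t \<le> 1"
      using powr_mono2[of "1 / real p" t 1] by (auto simp: u_def)
    with t show "0 \<le> c t \<and> 0 \<le> u t \<and> u t \<le> 1" by (auto simp: c_def)
  qed
  from cm_integral_geometric[OF int this]
  have "completely_monotone_upto k (\<lambda>n. \<integral>t. c t * u t ^ n \<partial>fp_measure)" .
  moreover have "(\<integral>t. c t * u t ^ n \<partial>fp_measure) = (\<integral>t. b (Suc n) t \<partial>fp_measure) - (\<integral>t. b n t \<partial>fp_measure)" for n
  proof -
    have "(\<integral>t. b (Suc n) t \<partial>fp_measure) - (\<integral>t. b n t \<partial>fp_measure) = (\<integral>t. b (Suc n) t - b n t \<partial>fp_measure)"
      by (intro Bochner_Integration.integral_diff[symmetric] b_int)
    also have "\<dots> = (\<integral>t. c t * u t ^ n \<partial>fp_measure)"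
      using AE_step b_int int by (intro integral_cong_AE) auto
    finally show ?thesis ..
  qed
  ultimately show ?thesis unfolding b_integral by simp
qed

lemma has_unit_moments_distr_power:
  assumes "has_unit_moments N a" "0 < p"
  shows "has_unit_moments (distr N borel (\<lambda>x. x ^ p)) (\<lambda>n. a (p * n))"
proof -
  interpret N: real_distribution N using assms by (simp add: has_unit_moments_def)
  have "AE t in N. 0 \<le> t \<and> t \<le> 1"
    using assms(1) by (simp add: has_unit_moments_def)
  then have "AE t in N. 0 \<le> t ^ p \<and> t ^ p \<le> 1"
    by (rule eventually_mono) (simp add: power_le_one)
  moreover have "(\<integral>x. (x ^ p) ^ n \<partial>N) = a (p * n)" for n
    using assms(1) by (simp add: has_unit_moments_def power_mult[symmetric])
  moreover have "real_distribution (distr N borel (\<lambda>x. x ^ p))"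
    by (auto simp: real_distribution_def real_distribution_axioms_def intro!: N.prob_space_distr)
  ultimately show ?thesis
    by (simp add: has_unit_moments_def AE_distr_iff integral_distr)
qed

text \<open>The measure \<open>N\<close> is a \<open>p\<close>-th root of the fixed point measure:
  substituting \<open>t = x ^ p\<close> turns the Mellin transform at \<open>n / p\<close> into the
  \<open>n\<close>-th moment of \<open>N\<close>, which is \<open>1 / s n\<close> by
  construction.\<close>

lemma bernstein_f_mellin_F_rational:
  assumes "0 < p" "0 < n"
  shows "bernstein_f (1 + complex_of_real (real n / real p)) * mellin_F (complex_of_real (real n / real p)) = 1"
proof -
  define s where "s n = Re (bernstein_f (1 + complex_of_real (real n / real p)))" for n
  have s_pos: "0 < s n" for n
    unfolding s_def by (intro Re_bernstein_f_pos) (simp add: add_pos_nonneg)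
  have s_eq: "bernstein_f (1 + complex_of_real (real n / real p)) = complex_of_real (s n)" for n
    using bernstein_f_of_real[of "1 + real n / real p"] by (simp add: s_def)
  have s_mult: "1 / s (p * n) = fp_seq n" for n
  proof -
    have "complex_of_real (s (p * n)) = bernstein_f (of_nat (Suc n))"
      unfolding s_eq[symmetric] using assms by simp
    then show ?thesis unfolding bernstein_f_nat of_real_eq_iff by simp
  qed
  have "completely_monotone_upto k (\<lambda>n. 1 / s n)" for k
    using bernstein_f_step_cm[OF assms(1)] s_pos unfolding s_def by (intro cm_inverse) auto
  moreover have "1 / s 0 = 1" using s_mult[of 0] by (simp add: fp_seq_0)
  ultimately obtain N where N: "has_unit_moments N (\<lambda>n. 1 / s n)"
    using hausdorff_moment_existence by blast
  interpret N: real_distribution N using N by (simp add: has_unit_moments_def)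
  have AE: "AE x in N. 0 \<le> x \<and> x \<le> 1" using N by (simp add: has_unit_moments_def)
  have "has_unit_moments (distr N borel (\<lambda>x. x ^ p)) fp_seq"
    using has_unit_moments_distr_power[OF N assms(1)] unfolding s_mult .
  then have eq: "fp_measure = distr N borel (\<lambda>x. x ^ p)"
    by (rule hausdorff_moment_unique[OF has_unit_moments_fp_measure])
  have "mellin_F (complex_of_real (real n / real p))
      = (\<integral>x. cpow_real (x ^ p) (complex_of_real (real n / real p)) \<partial>N)"
    unfolding mellin_F_def eq by (rule integral_distr) auto
  also have "\<dots> = (\<integral>x. complex_of_real (x ^ n) \<partial>N)"
  proof (rule integral_cong_AE)
    show "AE x in N. cpow_real (x ^ p) (complex_of_real (real n / real p)) = complex_of_real (x ^ n)"
      using AE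
    proof (rule eventually_mono)
      fix x :: real assume x: "0 \<le> x \<and> x \<le> 1"
      \<comment> \<open>At \<open>x = 0\<close> the left side is \<open>0\<close>, and the right
        side is too since \<open>0 < n\<close>.\<close>
      have "(x ^ p) powr (real n / real p) = x ^ n"
        using x assms by (cases "x = 0") (simp_all add: powr_realpow[symmetric] powr_powr zero_power)
      then show "cpow_real (x ^ p) (complex_of_real (real n / real p)) = complex_of_real (x ^ n)"
        using x by (subst cpow_real_of_real) auto
    qed
  qed auto
  also have "\<dots> = complex_of_real (1 / s n)"
    unfolding integral_complex_of_real using N by (simp add: has_unit_moments_def)
  finally show ?thesis using less_imp_neq[OF s_pos[of n]] unfolding s_eq by simp
qed

lemma bernstein_f_mellin_F:
  assumes "0 < Re z"
  shows "bernstein_f (z + 1) * mellin_F z = 1"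
proof -
  let ?g = "\<lambda>z. bernstein_f (z + 1) * mellin_F z - 1"
  have "?g z = 0"
  proof (rule analytic_continuation[of ?g "{z. 0 < Re z}" "range (\<lambda>n. 1 + complex_of_real (1 / real (Suc n)))" 1])
    have "(bernstein_f \<circ> (\<lambda>z. z + 1)) holomorphic_on {z. 0 < Re z}"
      by (rule holomorphic_on_compose_gen[OF _ bernstein_f_holomorphic]) (auto intro!: holomorphic_intros)
    then show "?g holomorphic_on {z. 0 < Re z}"
      using mellin_F_holomorphic by (auto simp: o_def intro!: holomorphic_intros)
    show "connected {z. 0 < Re z}" by (intro convex_connected convex_halfspace_Re_gt)
    \<comment> \<open>The limit \<open>1\<close> of these rationals is interior to the half-plane,
      whereas the points \<open>1 / (n + 1)\<close> would tend to its boundary.\<close>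
    show "1 islimpt range (\<lambda>n. 1 + complex_of_real (1 / real (Suc n)))"
      unfolding islimpt_sequential
    proof (intro exI conjI allI)
      have "(\<lambda>n. complex_of_real (1 / real (Suc n))) \<longlonglongrightarrow> complex_of_real 0"
        using LIMSEQ_inverse_real_of_nat by (intro tendsto_of_real) (simp add: field_simps)
      from tendsto_add[OF tendsto_const[of 1] this]
      show "(\<lambda>n. 1 + complex_of_real (1 / real (Suc n))) \<longlonglongrightarrow> 1" by simp
    qed (auto simp: complex_eq_iff)
    fix w assume "w \<in> range (\<lambda>n. 1 + complex_of_real (1 / real (Suc n)))"
    then obtain n where "w = complex_of_real (1 + 1 / real (Suc n))" by auto
    moreover have "1 + 1 / real (Suc n) = real (Suc (Suc n)) / real (Suc n)"
      by (simp add: field_simps)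
    ultimately have w: "w = complex_of_real (real (Suc (Suc n)) / real (Suc n))" by (simp only:)
    have "bernstein_f (1 + w) * mellin_F w = 1"
      unfolding w by (rule bernstein_f_mellin_F_rational) auto
    then show "?g w = 0" by (simp add: add.commute)
  qed (use assms in \<open>auto simp: open_halfspace_Re_gt intro!: add_pos_nonneg\<close>)
  then show ?thesis by simp
qed

section \<open>Meromorphic continuation\<close>

text \<open>With \<open>1 / 0 = 0\<close> the iterates of \<open>psi\<close> are total, and the functional equation of the
  continuation holds at every point, poles included.\<close>

definition psi :: "complex \<Rightarrow> complex" where
  "psi w = w - 1 / w"

text \<open>The shift count brings the real part strictly above \<open>0\<close>, and
  \<open>nat\<close> clips it to \<open>0\<close> far to the right. By
  \<open>bernstein_ext_eq\<close> any sufficient shift gives the same value.\<close>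

definition bernstein_ext :: "complex \<Rightarrow> complex" where
  "bernstein_ext z = (psi ^^ nat (\<lceil>- Re z\<rceil> + 1)) (bernstein_f (z + of_nat (nat (\<lceil>- Re z\<rceil> + 1))))"

definition mellin_ext :: "complex \<Rightarrow> complex" where
  "mellin_ext z = 1 / bernstein_ext (z + 1)"

lemma bernstein_f_eq_psi:
  assumes "0 < Re z" shows "bernstein_f z = psi (bernstein_f (z + 1))"
proof -
  have "mellin_F z = 1 / bernstein_f (z + 1)"
    using bernstein_f_mellin_F[OF assms] by (metis mult_eq_0_iff nonzero_eq_divide_eq zero_neq_one mult.commute)
  then show ?thesis using bernstein_f_diff[OF assms] by (simp add: psi_def algebra_simps)
qed

text \<open>Each surplus \<open>psi\<close> cancels one surplus unit of shift, by the functional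
  equation in the right half-plane.\<close>

lemma psi_funpow_bernstein_f_add:
  assumes "0 < Re z + real k"
  shows "(psi ^^ (k + j)) (bernstein_f (z + of_nat (k + j))) = (psi ^^ k) (bernstein_f (z + of_nat k))"
proof (induction j)
  case (Suc j)
  have "(psi ^^ (k + Suc j)) (bernstein_f (z + of_nat (k + Suc j)))
      = (psi ^^ (k + j)) (psi (bernstein_f (z + of_nat (k + j) + 1)))"
    by (simp add: funpow_Suc_right add_ac del: funpow.simps)
  also have "psi (bernstein_f (z + of_nat (k + j) + 1)) = bernstein_f (z + of_nat (k + j))"
    using assms by (intro bernstein_f_eq_psi[symmetric]) simp
  finally show ?case using Suc.IH by simp
qed simp

lemma bernstein_ext_eq:
  assumes "0 < Re z + real k"
  shows "bernstein_ext z = (psi ^^ k) (bernstein_f (z + of_nat k))"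
proof -
  define l where "l = nat (\<lceil>- Re z\<rceil> + 1)"
  have l: "0 < Re z + real l" unfolding l_def by linarith
  have "(psi ^^ l) (bernstein_f (z + of_nat l)) = (psi ^^ k) (bernstein_f (z + of_nat k))"
    using psi_funpow_bernstein_f_add[OF l, of "k - l"] psi_funpow_bernstein_f_add[OF assms, of "l - k"]
    by (cases "l \<le> k") auto
  then show ?thesis by (simp add: bernstein_ext_def l_def)
qed

lemma bernstein_ext_eq_bernstein_f: "0 < Re z \<Longrightarrow> bernstein_ext z = bernstein_f z"
  using bernstein_ext_eq[of z 0] by simp

lemma bernstein_ext_eq_psi: "bernstein_ext z = psi (bernstein_ext (z + 1))"
proof -
  obtain k where "- Re z < real k" using reals_Archimedean2 by blast
  then show ?thesis
    using bernstein_ext_eq[of "z + 1" k] bernstein_ext_eq[of z "Suc k"] by (simp add: add_ac)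
qed

lemma bernstein_ext_eq_diff: "bernstein_ext (z + 1) - 1 / bernstein_ext (z + 1) = bernstein_ext z"
  using bernstein_ext_eq_psi[of z] by (simp add: psi_def)

lemma psi_funpow_meromorphic:
  assumes "h meromorphic_on A" shows "(\<lambda>z. (psi ^^ k) (h z)) meromorphic_on A"
proof (induction k)
  case (Suc k)
  then show ?case by (auto simp: psi_def[of "(psi ^^ k) _"] intro!: meromorphic_intros)
qed (use assms in simp)

text \<open>On each half-plane a single shift count works, so there the continuation is a finite
  iterate of the rational map \<open>psi\<close> applied to a holomorphic function.\<close>

lemma bernstein_ext_meromorphic: "bernstein_ext meromorphic_on UNIV"
  unfolding meromorphic_on_meromorphic_at[of _ UNIV]
proof
  fix z :: complex
  obtain k where k: "- Re z < real k" using reals_Archimedean2 by blast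
  let ?A = "{w. - real k < Re w}"
  have op: "open ?A" by (rule open_halfspace_Re_gt)
  have "(\<lambda>w. bernstein_f (w + of_nat k)) holomorphic_on ?A"
  proof -
    have "(bernstein_f \<circ> (\<lambda>w. w + of_nat k)) holomorphic_on ?A"
      by (rule holomorphic_on_compose_gen[OF _ bernstein_f_holomorphic]) (auto intro!: holomorphic_intros)
    then show ?thesis by (simp add: o_def)
  qed
  then have "(\<lambda>w. bernstein_f (w + of_nat k)) meromorphic_on ?A"
    using op by (intro analytic_on_imp_meromorphic_on) (simp add: analytic_on_open)
  then have "(\<lambda>w. (psi ^^ k) (bernstein_f (w + of_nat k))) meromorphic_on ?A"
    by (rule psi_funpow_meromorphic)
  also have "?this \<longleftrightarrow> bernstein_ext meromorphic_on ?A"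
  proof (rule meromorphic_on_cong)
    fix w assume "w \<in> ?A"
    then have "eventually (\<lambda>u. u \<in> ?A) (at w)"
      using op by (rule eventually_at_in_open'[rotated])
    then show "eventually (\<lambda>u. (psi ^^ k) (bernstein_f (u + of_nat k)) = bernstein_ext u) (at w)"
      by eventually_elim (rule bernstein_ext_eq[symmetric], simp)
  qed simp
  finally show "bernstein_ext meromorphic_on {z}"
    by (rule meromorphic_on_subset) (use k in auto)
qed

lemma bernstein_ext_shift_meromorphic: "(\<lambda>z. bernstein_ext (z + 1)) meromorphic_on UNIV"
  by (rule meromorphic_on_compose[OF bernstein_ext_meromorphic]) (auto intro!: analytic_intros)

lemma mellin_ext_meromorphic: "mellin_ext meromorphic_on UNIV"
  unfolding mellin_ext_def using bernstein_ext_shift_meromorphic by (intro meromorphic_intros)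

lemma bernstein_ext_shift_nonzero: "-1 < Re z \<Longrightarrow> bernstein_ext (z + 1) \<noteq> 0"
  using Re_bernstein_f_pos[of "z + 1"] bernstein_ext_eq_bernstein_f[of "z + 1"] by auto

lemma bernstein_ext_shift_holomorphic: "(\<lambda>z. bernstein_ext (z + 1)) holomorphic_on {z. -1 < Re z}"
proof -
  have "(bernstein_f \<circ> (\<lambda>w. w + 1)) holomorphic_on {z. -1 < Re z}"
    by (rule holomorphic_on_compose_gen[OF _ bernstein_f_holomorphic]) (auto intro!: holomorphic_intros)
  then show ?thesis
    by (rule holomorphic_transform) (simp add: bernstein_ext_eq_bernstein_f)
qed

lemma mellin_ext_holomorphic: "mellin_ext holomorphic_on {z. -1 < Re z}"
  unfolding mellin_ext_def using bernstein_ext_shift_holomorphic bernstein_ext_shift_nonzero by (auto intro!: holomorphic_intros)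

text \<open>One unit to the left of the original half-plane no pole appears, because the subtracted
  \<open>1 / f (z + 1)\<close> has a denominator of positive real part there.\<close>

lemma bernstein_ext_holomorphic: "bernstein_ext holomorphic_on {z. -1 < Re z}"
proof -
  have "(\<lambda>z. bernstein_ext (z + 1) - mellin_ext z) holomorphic_on {z. -1 < Re z}"
    by (intro holomorphic_intros bernstein_ext_shift_holomorphic mellin_ext_holomorphic)
  then show ?thesis
    by (rule holomorphic_transform) (simp add: bernstein_ext_eq_diff mellin_ext_def)
qed

lemma mellin_ext_eq_mellin_F:
  assumes "0 < Re z" shows "mellin_ext z = mellin_F z"
  using bernstein_f_mellin_F[OF assms] bernstein_ext_shift_nonzero[of z] bernstein_ext_eq_bernstein_f[of "z + 1"] assms
  by (simp add: mellin_ext_def field_simps)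

section \<open>Zeros of the continuation and the poles at -1\<close>

text \<open>A meromorphic function on the plane either vanishes off a sparse set or has only sparse
  zeros, and near \<open>0\<close> this one has none. The exceptional set matters: where the value
  is \<open>0\<close>, the convention \<open>1 / 0 = 0\<close> makes the product with
  \<open>mellin_ext z\<close> equal to \<open>0\<close> instead of \<open>1\<close>.\<close>

lemma bernstein_ext_shift_nonzero_cosparse: "\<forall>\<^sub>\<approx>z. bernstein_ext (z + 1) \<noteq> 0"
proof -
  have "\<not> (\<forall>\<^sub>\<approx>z. bernstein_ext (z + 1) = 0)"
  proof
    assume "\<forall>\<^sub>\<approx>z. bernstein_ext (z + 1) = 0"
    then have "eventually (\<lambda>z. bernstein_ext (z + 1) = 0) (at 0)"
      by (rule eventually_cosparse_imp_eventually_at) auto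
    moreover have "eventually (\<lambda>z. z \<in> {z. -1 < Re z}) (at 0)"
      by (rule eventually_at_in_open') (auto simp: open_halfspace_Re_gt)
    ultimately have "eventually (\<lambda>z::complex. False) (at 0)"
      by eventually_elim (use bernstein_ext_shift_nonzero in auto)
    then show False by simp
  qed
  then show ?thesis
    using meromorphic_imp_constant_or_avoid[OF bernstein_ext_shift_meromorphic, of 0] by auto
qed

lemma bernstein_f_1: "bernstein_f 1 = 1"
  using bernstein_f_nat[of 0] by (simp add: fp_seq_0)

text \<open>The pole at \<open>-1\<close> comes from \<open>bernstein_ext 0 = psi 1 = 0\<close>.\<close>

lemma bernstein_ext_shift_filterlim: "filterlim (\<lambda>z. bernstein_ext (z + 1)) (at 0) (at (-1))"
proof -
  have "isCont bernstein_ext 0"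
    using holomorphic_on_imp_continuous_on[OF bernstein_ext_holomorphic]
    by (rule continuous_on_interior) (simp add: interior_open open_halfspace_Re_gt)
  moreover have "bernstein_ext 0 = 0"
    using bernstein_ext_eq_psi[of 0] bernstein_ext_eq_bernstein_f[of 1] by (simp add: bernstein_f_1 psi_def)
  ultimately have "((\<lambda>z. bernstein_ext (z + 1)) \<longlongrightarrow> 0) (at (-1))"
    by (intro isCont_tendsto_compose[of "0" bernstein_ext, THEN tendsto_eq_rhs]) (auto intro!: tendsto_eq_intros)
  moreover have "eventually (\<lambda>z. bernstein_ext (z + 1) \<noteq> 0) (at (-1))"
    by (rule eventually_cosparse_imp_eventually_at[OF bernstein_ext_shift_nonzero_cosparse]) auto
  ultimately show ?thesis by (simp add: filterlim_at)
qed

lemma is_pole_mellin_ext: "is_pole mellin_ext (-1)"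
  unfolding mellin_ext_def by (rule is_pole_divide[OF _ bernstein_ext_shift_filterlim]) auto

text \<open>In \<open>f z = f (z + 1) - 1 / f (z + 1)\<close> the first term tends to
  \<open>0\<close> at \<open>-1\<close>, so the pole of the second one survives.\<close>

lemma is_pole_bernstein_ext: "is_pole bernstein_ext (-1)"
proof -
  have "is_pole (\<lambda>z. -1 / bernstein_ext (z + 1)) (-1)"
    by (rule is_pole_divide[OF _ bernstein_ext_shift_filterlim]) auto
  then have "filterlim (\<lambda>z. bernstein_ext (z + 1) + -1 / bernstein_ext (z + 1)) at_infinity (at (-1))"
    using bernstein_ext_shift_filterlim unfolding is_pole_def filterlim_at
    by (intro tendsto_add_filterlim_at_infinity) auto
  also have "(\<lambda>z. bernstein_ext (z + 1) + -1 / bernstein_ext (z + 1)) = bernstein_ext"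
    using bernstein_ext_eq_diff by (simp add: fun_eq_iff)
  finally show ?thesis unfolding is_pole_def .
qed

section \<open>Power series at 1 and convergence of the integrals\<close>

text \<open>Taylor coefficient at \<open>w = 0\<close> of \<open>F (1 - w)\<close>, from expanding
  \<open>t^(1 - w) = t * exp (- w * ln t)\<close>. Centring at \<open>1\<close> supplies the factor
  \<open>t\<close>, which keeps the integrand bounded near \<open>0\<close>.\<close>

definition log_moment :: "nat \<Rightarrow> real" where
  "log_moment n = (\<integral>t. t * (- ln t) ^ n / fact n \<partial>fp_measure)"

lemma exp_series_bound:
  assumes "0 \<le> (x::real)" shows "(\<Sum>n<N. x ^ n / fact n) \<le> exp x"
proof -
  have s: "(\<lambda>n. x ^ n / fact n) sums exp x"
    using exp_converges[of x] by (simp add: divide_inverse mult.commute)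
  from sum_le_suminf[OF sums_summable[OF s], of "{..<N}"] assms show ?thesis
    using sums_unique[OF s] by simp
qed

lemma power_minus_mult_swap: "(- r * l) ^ n = (- l) ^ n * r ^ n" for r l :: "'a::comm_ring_1"
proof -
  have "- r * l = - l * r" by simp
  then show ?thesis by (simp only: power_mult_distrib)
qed

text \<open>A partial sum, with nonnegative terms, of the series of
  \<open>t * exp (- r * ln t) = t^(1 - r)\<close>, which is at most \<open>1\<close> because
  \<open>r \<le> 1\<close>.\<close>

lemma log_term_bound:
  fixes t r :: real
  assumes t: "0 \<le> t" "t \<le> 1" and r: "0 \<le> r" "r \<le> 1"
  shows "(\<Sum>n<N. t * (- ln t) ^ n / fact n * r ^ n) \<le> 1"
proof (cases "t = 0")
  case False
  have "(\<Sum>n<N. t * (- ln t) ^ n / fact n * r ^ n) = t * (\<Sum>n<N. (- r * ln t) ^ n / fact n)"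
    unfolding sum_distrib_left power_minus_mult_swap by (intro sum.cong refl) simp
  also have "\<dots> \<le> t * exp (- r * ln t)"
    using t r False by (intro mult_left_mono exp_series_bound) (auto simp: mult_nonneg_nonpos)
  also have "\<dots> = t powr (1 - r)"
    using False t by (simp add: powr_def exp_diff left_diff_distrib exp_minus field_simps)
  also have "\<dots> \<le> 1"
    using powr_mono2[of "1 - r" t 1] t r by simp
  finally show ?thesis .
qed simp

lemma log_term_nonneg: "0 \<le> t \<Longrightarrow> t \<le> 1 \<Longrightarrow> 0 \<le> t * (- ln t) ^ n / fact n" for t :: real
  by (cases "t = 0") auto

lemma log_term_le_1:
  assumes "0 \<le> t" "t \<le> (1::real)" shows "t * (- ln t) ^ n / fact n \<le> 1"
proof -
  have "t * (- ln t) ^ n / fact n \<le> (\<Sum>i<Suc n. t * (- ln t) ^ i / fact i * 1 ^ i)"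
    using log_term_nonneg[OF assms] by (simp add: sum_nonneg)
  also have "\<dots> \<le> 1" using assms by (intro log_term_bound) auto
  finally show ?thesis .
qed

lemma log_moment_integrable: "integrable fp_measure (\<lambda>t. t * (- ln t) ^ n / fact n)"
proof (rule fp_integrable_bounded)
  fix t :: real assume "0 \<le> t" "t \<le> 1"
  then show "norm (t * (- ln t) ^ n / fact n) \<le> 1"
    using log_term_nonneg[of t n] log_term_le_1[of t n] unfolding real_norm_def by linarith
qed measurable

lemma log_moment_nonneg: "0 \<le> log_moment n"
  unfolding log_moment_def
  by (rule integral_nonneg_AE, rule eventually_mono[OF fp_AE_unit]) (use log_term_nonneg in blast)

lemma summable_log_moment:
  assumes "0 \<le> r" "r \<le> 1" shows "summable (\<lambda>n. log_moment n * r ^ n)"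
proof (rule summableI_nonneg_bounded)
  show "0 \<le> log_moment n * r ^ n" for n using log_moment_nonneg assms by simp
  fix N
  have "(\<Sum>n<N. log_moment n * r ^ n) = (\<integral>t. (\<Sum>n<N. t * (- ln t) ^ n / fact n * r ^ n) \<partial>fp_measure)"
    unfolding log_moment_def integral_mult_left_zero[symmetric]
    by (intro Bochner_Integration.integral_sum[symmetric] integrable_mult_left log_moment_integrable)
  also have "\<dots> \<le> (\<integral>t. 1 \<partial>fp_measure)"
  proof (rule integral_mono_AE)
    show "AE t in fp_measure. (\<Sum>n<N. t * (- ln t) ^ n / fact n * r ^ n) \<le> 1"
      using fp_AE_unit by (rule eventually_mono) (use log_term_bound assms in blast)
  qed (intro Bochner_Integration.integrable_sum integrable_mult_left log_moment_integrable, simp)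
  also have "\<dots> = 1" by (simp add: fp.prob_space del: fp.space_eq_univ)
  finally show "(\<Sum>n<N. log_moment n * r ^ n) \<le> 1" .
qed

lemma mellin_F_power_series:
  assumes w: "norm w < 1"
  shows "(\<lambda>n. complex_of_real (log_moment n) * w ^ n) sums mellin_F (1 - w)"
proof -
  let ?f = "\<lambda>n t. complex_of_real (t * (- ln t) ^ n / fact n) * w ^ n"
  have norm_f: "norm (?f n t) = t * (- ln t) ^ n / fact n * norm w ^ n" if "0 \<le> t" "t \<le> 1" for n t
    unfolding norm_mult[of _ "w ^ n"] norm_of_real norm_power abs_of_nonneg[OF log_term_nonneg[OF that]] ..
  have AE_norm_f: "AE t in fp_measure. norm (?f n t) = t * (- ln t) ^ n / fact n * norm w ^ n" for n
    using fp_AE_unit by (rule eventually_mono) (use norm_f in blast)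
  have int: "integrable fp_measure (?f n)" for n
    by (intro integrable_mult_left integrable_of_real log_moment_integrable)
  have f_sums: "(\<lambda>n. ?f n t) sums cpow_real t (1 - w)" if t: "0 \<le> t" for t
  proof (cases "t = 0")
    case False
    have "(\<lambda>n. complex_of_real t * ((- w * complex_of_real (ln t)) ^ n /\<^sub>R fact n))
        sums (complex_of_real t * exp (- w * complex_of_real (ln t)))"
      by (intro sums_mult exp_converges)
    also have "complex_of_real t * exp (- w * complex_of_real (ln t)) = cpow_real t (1 - w)"
      using False t exp_of_real[of "ln t", where ?'a = complex]
      by (simp add: cpow_real_def left_diff_distrib exp_diff exp_minus field_simps)
    also have "(\<lambda>n. complex_of_real t * ((- w * complex_of_real (ln t)) ^ n /\<^sub>R fact n)) = (\<lambda>n. ?f n t)"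
    proof
      fix n
      have "(- w * complex_of_real (ln t)) ^ n = complex_of_real ((- ln t) ^ n) * w ^ n"
        unfolding power_minus_mult_swap by simp
      then show "complex_of_real t * ((- w * complex_of_real (ln t)) ^ n /\<^sub>R fact n) = ?f n t"
        by (simp add: scaleR_conv_of_real divide_inverse mult_ac)
    qed
    finally show ?thesis .
  qed (simp add: cpow_real_def)
  have "(\<lambda>n. \<integral>t. ?f n t \<partial>fp_measure) sums (\<integral>t. (\<Sum>n. ?f n t) \<partial>fp_measure)"
  proof (rule sums_integral[OF int])
    show "AE t in fp_measure. summable (\<lambda>n. norm (?f n t))"
      using fp_AE_unit
    proof (rule eventually_mono)
      fix t :: real assume t: "0 \<le> t \<and> t \<le> 1"
      show "summable (\<lambda>n. norm (?f n t))"
      proof (rule summableI_nonneg_bounded)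
        show "(\<Sum>n<N. norm (?f n t)) \<le> 1" for N
          using log_term_bound[of t "norm w" N] t w norm_f by simp
      qed simp
    qed
    have "(\<integral>t. norm (?f n t) \<partial>fp_measure) = log_moment n * norm w ^ n" for n
    proof -
      have "(\<integral>t. norm (?f n t) \<partial>fp_measure)
          = (\<integral>t. t * (- ln t) ^ n / fact n * norm w ^ n \<partial>fp_measure)"
        by (rule integral_cong_AE[OF _ _ AE_norm_f]) auto
      then show ?thesis unfolding log_moment_def integral_mult_left_zero .
    qed
    then show "summable (\<lambda>n. \<integral>t. norm (?f n t) \<partial>fp_measure)"
      using summable_log_moment[of "norm w"] w by simp
  qed
  moreover have "(\<integral>t. ?f n t \<partial>fp_measure) = complex_of_real (log_moment n) * w ^ n" for n
    unfolding integral_mult_left_zero integral_complex_of_real log_moment_def ..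
  moreover have "(\<integral>t. (\<Sum>n. ?f n t) \<partial>fp_measure) = mellin_F (1 - w)"
    unfolding mellin_F_def
  proof (rule integral_cong_AE)
    show "AE t in fp_measure. (\<Sum>n. ?f n t) = cpow_real t (1 - w)"
      using fp_AE_unit by (rule eventually_mono) (rule f_sums[THEN sums_unique, symmetric], simp)
  qed auto
  ultimately show ?thesis by (simp only:)
qed

text \<open>Landau's argument: all Taylor coefficients of \<open>\<lambda>w. mellin_ext (1 - w)\<close> at \<open>0\<close> are nonnegative,
  so the expansion on the disc of radius \<open>2\<close> integrates termwise by monotone convergence.\<close>

lemma mellin_ext_power_series:
  assumes "norm w < 2"
  shows "(\<lambda>n. complex_of_real (log_moment n) * w ^ n) sums mellin_ext (1 - w)"
proof -
  define G where "G w = mellin_ext (1 - w)" for w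
  define c where "c n = (deriv ^^ n) G 0 / fact n" for n
  have "(mellin_ext \<circ> (\<lambda>w. 1 - w)) holomorphic_on ball 0 2"
  proof (rule holomorphic_on_compose_gen[OF _ mellin_ext_holomorphic])
    show "(\<lambda>w. 1 - w) ` ball 0 2 \<subseteq> {z. -1 < Re z}"
    proof safe
      fix w :: complex assume "w \<in> ball 0 2"
      then show "-1 < Re (1 - w)" using complex_Re_le_cmod[of w] by simp
    qed
  qed (auto intro!: holomorphic_intros)
  then have "G holomorphic_on ball 0 2" by (simp add: G_def[abs_def] o_def)
  then have c_sums: "(\<lambda>n. c n * w ^ n) sums G w" if "norm w < 2" for w
    using holomorphic_power_series[of G 0 2 w] that by (simp add: c_def)
  have l_sums: "(\<lambda>n. complex_of_real (log_moment n) * w ^ n) sums G w" if "norm w < 1" for w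
    using mellin_F_power_series[OF that] complex_Re_le_cmod[of w] that mellin_ext_eq_mellin_F[of "1 - w"]
    by (simp add: G_def)
  \<comment> \<open>Both series represent \<open>G\<close> on the unit disc, so their coefficients
    agree; this carries the convergence of the Taylor series on the disc of radius \<open>2\<close>
    over to the log moments.\<close>
  have "Abs_fps c = Abs_fps (\<lambda>n. complex_of_real (log_moment n))"
  proof (rule eval_fps_eqD)
    have "ereal (norm (1 / 2 :: complex)) \<le> conv_radius c"
      using sums_summable[OF c_sums[of "1 / 2"]] by (intro conv_radius_geI) auto
    then show "0 < fps_conv_radius (Abs_fps c)"
      by (auto simp: fps_conv_radius_def intro: less_le_trans[rotated])
    have "ereal (norm (1 / 2 :: complex)) \<le> conv_radius (\<lambda>n. complex_of_real (log_moment n))"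
      using sums_summable[OF l_sums[of "1 / 2"]] by (intro conv_radius_geI) auto
    then show "0 < fps_conv_radius (Abs_fps (\<lambda>n. complex_of_real (log_moment n)))"
      by (auto simp: fps_conv_radius_def intro: less_le_trans[rotated])
    have "eventually (\<lambda>z. z \<in> ball 0 1) (nhds (0::complex))"
      by (rule eventually_nhds_in_open) auto
    then show "eventually (\<lambda>z. eval_fps (Abs_fps c) z = eval_fps (Abs_fps (\<lambda>n. complex_of_real (log_moment n))) z) (nhds 0)"
    proof eventually_elim
      case (elim z)
      then have "norm z < 1" by simp
      then show ?case
        using sums_unique[OF c_sums[of z]] sums_unique[OF l_sums[of z]] by (simp add: eval_fps_def)
    qed
  qed
  then have "c = (\<lambda>n. complex_of_real (log_moment n))"
    by (simp add: fps_eq_iff fun_eq_iff)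
  then show ?thesis using c_sums[OF assms] by (simp add: G_def)
qed

text \<open>For \<open>x \<le> 1\<close> the number \<open>r = 1 - x\<close> is nonnegative, so all
  terms of the expansion are nonnegative and sum and integral may be exchanged. The common value
  \<open>v\<close> ties the actual integral to the continuation.\<close>

lemma nn_integral_powr_eq_mellin_ext:
  assumes "-1 < x" "x \<le> 1"
  shows "\<exists>v\<ge>0. (\<integral>\<^sup>+t. ennreal (t powr x) \<partial>fp_measure) = ennreal v \<and> mellin_ext (complex_of_real x) = complex_of_real v"
proof -
  define r where "r = 1 - x"
  have r: "0 \<le> r" "r < 2" using assms by (auto simp: r_def)
  have "1 - complex_of_real r = complex_of_real x" by (simp add: r_def)
  then have "(\<lambda>n. complex_of_real (log_moment n) * complex_of_real r ^ n) sums mellin_ext (complex_of_real x)"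
    using mellin_ext_power_series[of "complex_of_real r"] r by simp
  then have sums: "(\<lambda>n. complex_of_real (log_moment n * r ^ n)) sums mellin_ext (complex_of_real x)"
    by simp
  then have "summable (\<lambda>n. log_moment n * r ^ n)"
    using sums_summable summable_complex_of_real by blast
  then have real_sums: "(\<lambda>n. log_moment n * r ^ n) sums (\<Sum>n. log_moment n * r ^ n)"
    by (rule summable_sums)
  define v where "v = (\<Sum>n. log_moment n * r ^ n)"
  have v: "mellin_ext (complex_of_real x) = complex_of_real v"
    using sums_unique2[OF sums sums_of_real[OF real_sums]] by (simp add: v_def)
  have nonneg: "0 \<le> log_moment n * r ^ n" for n using log_moment_nonneg r by simp
  have v0: "0 \<le> v" unfolding v_def by (rule suminf_nonneg[OF sums_summable[OF real_sums] nonneg])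
  have pointwise: "ennreal (t powr x) = (\<Sum>n. ennreal (t * (- ln t) ^ n / fact n * r ^ n))"
    if t: "0 \<le> t" "t \<le> 1" for t
  proof -
    have "(\<lambda>n. t * (- ln t) ^ n / fact n * r ^ n) sums (t powr x)"
    proof (cases "t = 0")
      case False
      have "(\<lambda>n. t * ((- r * ln t) ^ n /\<^sub>R fact n)) sums (t * exp (- r * ln t))"
        by (intro sums_mult exp_converges)
      also have "t * exp (- r * ln t) = t powr x"
        using False t by (simp add: r_def powr_def left_diff_distrib exp_diff exp_minus field_simps)
      also have "(\<lambda>n. t * ((- r * ln t) ^ n /\<^sub>R fact n)) = (\<lambda>n. t * (- ln t) ^ n / fact n * r ^ n)"
        unfolding power_minus_mult_swap by (simp add: fun_eq_iff divide_inverse mult_ac)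
      finally show ?thesis .
    qed simp
    then show ?thesis
      using log_term_nonneg[OF t] r by (intro suminf_ennreal_eq[symmetric] mult_nonneg_nonneg) auto
  qed
  have "(\<integral>\<^sup>+t. ennreal (t powr x) \<partial>fp_measure)
      = (\<integral>\<^sup>+t. (\<Sum>n. ennreal (t * (- ln t) ^ n / fact n * r ^ n)) \<partial>fp_measure)"
    by (rule nn_integral_cong_AE, rule eventually_mono[OF fp_AE_unit]) (use pointwise in blast)
  also have "\<dots> = (\<Sum>n. \<integral>\<^sup>+t. ennreal (t * (- ln t) ^ n / fact n * r ^ n) \<partial>fp_measure)"
    by (rule nn_integral_suminf) auto
  also have "\<dots> = (\<Sum>n. ennreal (log_moment n * r ^ n))"
  proof (intro suminf_cong)
    fix n
    have "AE t in fp_measure. 0 \<le> t * (- ln t) ^ n / fact n * r ^ n"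
      using fp_AE_unit
      by (rule eventually_mono) (use log_term_nonneg r in \<open>intro mult_nonneg_nonneg; simp\<close>)
    then have "(\<integral>\<^sup>+t. ennreal (t * (- ln t) ^ n / fact n * r ^ n) \<partial>fp_measure)
        = ennreal (\<integral>t. t * (- ln t) ^ n / fact n * r ^ n \<partial>fp_measure)"
      by (intro nn_integral_eq_integral integrable_mult_left log_moment_integrable)
    then show "(\<integral>\<^sup>+t. ennreal (t * (- ln t) ^ n / fact n * r ^ n) \<partial>fp_measure) = ennreal (log_moment n * r ^ n)"
      unfolding integral_mult_left_zero log_moment_def .
  qed
  also have "\<dots> = ennreal v"
    using real_sums nonneg unfolding v_def by (intro suminf_ennreal_eq) auto
  finally show ?thesis using v v0 by blast
qed

lemma nn_integral_powr_finite:
  assumes "-1 < x" shows "(\<integral>\<^sup>+t. ennreal (t powr x) \<partial>fp_measure) < \<infinity>"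
proof (cases "x \<le> 1")
  case True
  then show ?thesis using nn_integral_powr_eq_mellin_ext[OF assms] by auto
next
  case False
  have "(\<integral>\<^sup>+t. ennreal (t powr x) \<partial>fp_measure) \<le> (\<integral>\<^sup>+t. 1 \<partial>fp_measure)"
  proof (rule nn_integral_mono_AE, rule eventually_mono[OF fp_AE_unit])
    fix t :: real assume "0 \<le> t \<and> t \<le> 1"
    then show "ennreal (t powr x) \<le> 1" using powr_mono2[of x t 1] False by simp
  qed
  also have "\<dots> = 1" by (simp add: fp.emeasure_space_1 del: fp.space_eq_univ)
  finally show ?thesis by (auto intro: le_less_trans)
qed

text \<open>A finite value \<open>c\<close> would bound the continuation of \<open>F\<close> on the
  real interval from \<open>-1\<close> to \<open>1\<close>, contradicting its pole at
  \<open>-1\<close>.\<close>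

lemma nn_integral_inverse_infinite: "(\<integral>\<^sup>+t. ennreal (1 / t) \<partial>fp_measure) = \<infinity>"
proof (rule ccontr)
  assume "(\<integral>\<^sup>+t. ennreal (1 / t) \<partial>fp_measure) \<noteq> \<infinity>"
  then obtain c where c: "0 \<le> c" "(\<integral>\<^sup>+t. ennreal (1 / t) \<partial>fp_measure) = ennreal c"
    by (cases "\<integral>\<^sup>+t. ennreal (1 / t) \<partial>fp_measure") auto
  have bound: "norm (mellin_ext (complex_of_real x)) \<le> c" if x: "-1 < x" "x \<le> 1" for x
  proof -
    obtain v where v: "0 \<le> v" "(\<integral>\<^sup>+t. ennreal (t powr x) \<partial>fp_measure) = ennreal v"
      "mellin_ext (complex_of_real x) = complex_of_real v"
      using nn_integral_powr_eq_mellin_ext[OF x] by blast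
    have "ennreal v \<le> ennreal c"
      unfolding v(2)[symmetric] c(2)[symmetric]
    proof (rule nn_integral_mono_AE, rule eventually_mono[OF fp_AE_unit])
      fix t :: real assume t: "0 \<le> t \<and> t \<le> 1"
      show "ennreal (t powr x) \<le> ennreal (1 / t)"
      \<comment> \<open>At \<open>t = 0\<close> both integrands are \<open>0\<close> by convention,
        so the divergence comes from mass near \<open>0\<close> and not from an atom.\<close>
      proof (cases "t = 0")
        case False
        then have "t powr x \<le> t powr (-1)" using t x by (intro powr_mono') auto
        then show ?thesis using False t by (intro ennreal_leI) (simp add: powr_minus_divide)
      qed simp
    qed
    then show ?thesis using v(1,3) c(1) by simp
  qed
  have "eventually (\<lambda>z. c + 1 \<le> norm (mellin_ext z)) (at (-1))"
    using is_pole_mellin_ext c(1) unfolding is_pole_def filterlim_at_infinity[OF c(1)] by simp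
  then obtain d where d: "0 < d" "\<And>z. z \<noteq> -1 \<Longrightarrow> dist z (-1) < d \<Longrightarrow> c + 1 \<le> norm (mellin_ext z)"
    unfolding eventually_at by auto
  \<comment> \<open>Closer to \<open>-1\<close> than \<open>d\<close>; the cap keeps
    \<open>x\<close> at most \<open>0\<close>, inside the range of \<open>bound\<close>.\<close>
  define x where "x = -1 + min (d / 2) 1"
  have "dist (complex_of_real x) (-1) = \<bar>x + 1\<bar>"
    unfolding dist_norm using norm_of_real[of "x + 1", where ?'a = complex] by simp
  then have "dist (complex_of_real x) (-1) < d" using d(1) by (auto simp: x_def)
  moreover have "-1 < x" "x \<le> 1" using d(1) by (auto simp: x_def)
  moreover have "complex_of_real x \<noteq> -1" using \<open>-1 < x\<close> by (auto simp: complex_eq_iff)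
  ultimately show False using d(2) bound[of x] by fastforce
qed

theorem theorem1p1:
  "(\<exists>f F :: complex \<Rightarrow> complex.
      f meromorphic_on UNIV \<and> F meromorphic_on UNIV \<and>
      (\<forall>z. Re z > 0 \<longrightarrow> f z = bernstein_f z \<and> F z = mellin_F z) \<and>
      (\<forall>\<^sub>\<approx>z. f (z + 1) * F z = 1) \<and>
      (\<forall>\<^sub>\<approx>z. f z = f (z + 1) - 1 / f (z + 1)) \<and>
      f holomorphic_on {z. Re z > -1} \<and> F holomorphic_on {z. Re z > -1} \<and>
      is_pole f (-1) \<and> is_pole F (-1)) \<and>
  (\<forall>x::real. x > -1 \<longrightarrow> (\<integral>\<^sup>+ t. ennreal (t powr x) \<partial>fp_measure) < \<infinity>) \<and>
  ((\<integral>\<^sup>+ t. ennreal (1 / t) \<partial>fp_measure) = \<infinity>)"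
proof (intro conjI exI)
  show "\<forall>\<^sub>\<approx>z. bernstein_ext (z + 1) * mellin_ext z = 1"
    using bernstein_ext_shift_nonzero_cosparse by eventually_elim (simp add: mellin_ext_def)
  show "\<forall>\<^sub>\<approx>z. bernstein_ext z = bernstein_ext (z + 1) - 1 / bernstein_ext (z + 1)"
    by (intro always_eventually allI bernstein_ext_eq_diff[symmetric])
qed (use bernstein_ext_meromorphic mellin_ext_meromorphic bernstein_ext_eq_bernstein_f mellin_ext_eq_mellin_F bernstein_ext_holomorphic
    mellin_ext_holomorphic is_pole_bernstein_ext is_pole_mellin_ext nn_integral_powr_finite nn_integral_inverse_infinite in auto)

end
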